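(* Let $k \geq 2$ be an integer. For each prime $p\ge 3$ let $$L_k(x) = \sum_{i=1}^{p-1} \frac{x^i}{i^k}$$ be the truncated polylogarithm. Then $$N_{p}(L_k) \ll_{k} \frac{p}{\log p},$$ that is, there is a constant $C_k>0$ depending only on $k$ such that $N_p(L_k)\le C_k\, p/\log p$ for all primes $p\geq 3$.
   Context: For a prime $p\ge 3$ and a polynomial $F(x)$ with rational coefficients whose denominators are coprime to $p$, $N_p(F)$ denotes the number of solutions $x$ modulo $p$ of the congruence $F(x)\equiv 0 \bmod p$ (i.e. the number of roots in $\mathbb{F}_p$ of the reduction of $F$ modulo $p$). The polynomial $L_k$ depends on $p$. *)

theory Defs
  imports Complex_Main "HOL-Computational_Algebra.Polynomial" "HOL-Computational_Algebra.Primes"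
    "HOL-Number_Theory.Cong"
begin

definition p_integral :: "nat \<Rightarrow> rat \<Rightarrow> bool" where
  "p_integral p r \<longleftrightarrow> coprime (snd (quotient_of r)) (int p)"

(* Congruence in the ring of rationals with denominator coprime to p;
   meant for p-integral a and b. *)
definition rat_cong :: "nat \<Rightarrow> rat \<Rightarrow> rat \<Rightarrow> bool" where
  "rat_cong p a b \<longleftrightarrow> (\<exists>c. p_integral p c \<and> a - b = of_nat p * c)"

(* Meant for polynomials with p-integral coefficients: then the truth of the congruence
   depends only on x modulo p, and 0, ..., p - 1 represent the residue classes. *)
definition num_roots_mod :: "nat \<Rightarrow> rat poly \<Rightarrow> nat" where
  "num_roots_mod p F = card {x \<in> {0..<int p}. rat_cong p (poly F (of_int x)) 0}"

definition trunc_polylog :: "nat \<Rightarrow> nat \<Rightarrow> rat poly" where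
  "trunc_polylog k p = (\<Sum>i = 1..p - 1. monom (1 / of_nat i ^ k) i)"

lemma rat_cong_of_int:
  assumes "p > 0"
  shows "rat_cong p (of_int a) (of_int b) \<longleftrightarrow> [a = b] (mod int p)"
proof
  assume "rat_cong p (of_int a) (of_int b)"
  then obtain c where c: "p_integral p c" "of_int a - of_int b = of_nat p * c"
    by (auto simp: rat_cong_def)
  obtain n d where nd: "quotient_of c = (n, d)" by force
  have d: "d > 0" using quotient_of_denom_pos[OF nd] .
  have "of_int (a - b) * (of_int d :: rat) = of_int (int p * n)"
    using c(2) quotient_of_div[OF nd] d by (simp add: field_simps)
  then have "(a - b) * d = int p * n"
    by (metis of_int_eq_iff of_int_mult)
  then have "int p dvd (a - b) * d" by simp
  moreover have "coprime (int p) d"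
    using c(1) nd by (simp add: p_integral_def coprime_commute)
  ultimately have "int p dvd a - b"
    using coprime_dvd_mult_left_iff by blast
  then show "[a = b] (mod int p)" by (simp add: cong_iff_dvd_diff)
next
  assume "[a = b] (mod int p)"
  then obtain c where "a - b = int p * c"
    by (auto simp: cong_iff_dvd_diff)
  then have "of_int a - of_int b = (of_nat p :: rat) * of_int c"
    by (metis of_int_diff of_int_mult of_int_of_nat_eq)
  moreover have "p_integral p (of_int c)" by (simp add: p_integral_def)
  ultimately show "rat_cong p (of_int a) (of_int b)" by (auto simp: rat_cong_def)
qed

lemma p_integral_coeff_trunc_polylog:
  assumes "prime p"
  shows "p_integral p (coeff (trunc_polylog k p) i)"
proof (cases "i \<in> {1..p - 1}")
  case True
  then have "coeff (trunc_polylog k p) i = 1 / of_nat i ^ k"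
    by (simp add: trunc_polylog_def coeff_sum)
  also have "\<dots> = Fract 1 (int i ^ k)"
    by (simp add: Fract_of_int_quotient)
  finally have *: "quotient_of (coeff (trunc_polylog k p) i) = (1, int i ^ k)"
    using True by (simp add: quotient_of_Fract Rat.normalize_def)
  have "\<not> p dvd i" using True by (auto dest: dvd_imp_le)
  then have "coprime i p"
    using assms prime_imp_coprime coprime_commute by blast
  then have "coprime (int i ^ k) (int p)" by simp
  then show ?thesis by (simp add: p_integral_def *)
next
  case False
  then have "coeff (trunc_polylog k p) i = 0"
    unfolding trunc_polylog_def coeff_sum by (intro sum.neutral) auto
  then show ?thesis by (simp add: p_integral_def)
qed

end

theory Submission
  imports Defs "HOL-Number_Theory.Residues"
begin

text \<open>
  The proof is Stepanov's method, carried out with integer polynomials modulo p. Lift the truncated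
  polylogarithms to polynomials L_j over the integers and put E = x (1 - x) d/dx. Modulo p,

    E L_1 = x - x^p  and  E L_j = (1 - x) L_(j-1) for j > 1.

  So E preserves the combinations of monomials of degree at most C in L_1, ..., L_k with polynomial
  coefficients; on coefficient vectors it acts by a connection. At a residue s other than 0 and 1 with
  L_k(s) = 0, all monomials that contain L_k vanish, and since s^p = s, a coefficient that is a sum of
  terms x^(p b + a) takes the same value as one with terms x^(b + a), which has small degree when a and
  b are small. As monomials in k variables outnumber those in k - 1 variables by a factor (C + k) / k,
  the pigeonhole principle gives a coefficient vector v, not zero modulo p and with all its exponents
  p b + a satisfying a < A and b < B, such that F = sum of v_c L^c vanishes to order M at every such
  s. The degree of F is at most p (B + C). With B = C, the counting allows M of the order of C^2 / k,
  so there are at most O(k p / C) roots (lemma stepanov_bound).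

  This needs F to be nonzero modulo p, which follows from a zero estimate: a combination of the
  monomials with coefficients of small degree, not all zero modulo p, does not vanish modulo p and
  x^p. Suppose that it did. Then the coefficient vectors v, Dv, D^2 v, ... obtained from the
  connection D would also give combinations that vanish modulo p and x^p. Siegel's lemma finds in
  their span a vector w of degree less than p that is horizontal up to scaling
  (exists_horizontal_up_to_scaling). Comparing residues at 0 and at 1 in the equations for w shows
  that only its coefficient at the constant monomial is nonzero (top_of_horizontal_is_bottom). But
  then this coefficient has degree less than p and is divisible by x^p modulo p, a contradiction
  (zero_estimate). The degree bound on w is essential: multiplication by x^p commutes with E modulo p,
  so there are many more constants than scalars, and horizontal vectors of large degree need not be
  multiples of the constant monomial.

  The conditions on the parameters only ask p to exceed a fixed power of C. So C may grow like ln p,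
  which gives the bound p / ln p.
\<close>

hide_const (open) up_ring.monom up_ring.coeff module.smult

section \<open>Integer polynomials modulo a prime\<close>

lemma prime_const_poly_dvd_mult_iff:
  assumes "prime (p::int)"
  shows "[:p:] dvd f * g \<longleftrightarrow> [:p:] dvd f \<or> [:p:] dvd g"
  using assms prime_elem_const_poly_iff[of p] prime_elem_dvd_mult_iff by blast

lemma lowest_coeff_mult:
  fixes f g :: "int poly"
  assumes "\<And>i. i < m \<Longrightarrow> p dvd coeff f i" "\<And>i. i < e \<Longrightarrow> p dvd coeff g i"
  shows "p dvd coeff (f * g) (m + e) - coeff f m * coeff g e"
    and "i < m + e \<Longrightarrow> p dvd coeff (f * g) i"
proof -
  have "coeff (f * g) (m + e) - coeff f m * coeff g e
      = (\<Sum>i\<in>{..m + e} - {m}. coeff f i * coeff g (m + e - i))"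
    by (simp add: coeff_mult sum.remove[of "{..m+e}" m])
  also have "p dvd \<dots>"
  proof (rule dvd_sum)
    fix i assume "i \<in> {..m + e} - {m}"
    then have "i < m \<or> m + e - i < e" by auto
    then show "p dvd coeff f i * coeff g (m + e - i)" using assms by auto
  qed
  finally show "p dvd coeff (f * g) (m + e) - coeff f m * coeff g e" .
  assume i: "i < m + e"
  show "p dvd coeff (f * g) i"
    unfolding coeff_mult
  proof (rule dvd_sum)
    fix j assume "j \<in> {..i}"
    then have "j < m \<or> i - j < e" using i by auto
    then show "p dvd coeff f j * coeff g (i - j)" using assms by auto
  qed
qed

lemma obtain_lowest_coeff:
  assumes "\<not> [:p:] dvd (f::int poly)"
  obtains m where "\<not> p dvd coeff f m" "\<And>i. i < m \<Longrightarrow> p dvd coeff f i" "m \<le> degree f"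
proof -
  have ex: "\<exists>m. \<not> p dvd coeff f m" using assms by (auto simp: const_poly_dvd_iff)
  define m where "m = (LEAST m. \<not> p dvd coeff f m)"
  have 1: "\<not> p dvd coeff f m" unfolding m_def using ex by (rule LeastI_ex)
  have 2: "p dvd coeff f i" if "i < m" for i using not_less_Least that unfolding m_def by blast
  have 3: "m \<le> degree f" using 1 by (metis coeff_eq_0 dvd_0_right leI)
  show ?thesis using that 1 2 3 by blast
qed

lemma const_poly_dvd_pderiv: "[:p:] dvd f \<Longrightarrow> [:p:] dvd pderiv (f :: int poly)"
  by (auto simp: const_poly_dvd_iff coeff_pderiv)

definition wronskian :: "int poly \<Rightarrow> int poly \<Rightarrow> int poly" where
  "wronskian f g = pderiv f * g - f * pderiv g"

lemma coeff_theta: "coeff ([:0, 1:] * pderiv f) i = of_nat i * coeff (f::int poly) i"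
  by (cases i) (auto simp: coeff_pderiv coeff_pCons)

text \<open>The factor x turns the derivatives into x f' and x g', and x d/dx multiplies x^i by i. So the lowest
coefficient is that of f g, multiplied by the difference of the orders.\<close>

lemma wronskian_lowest_coeff:
  fixes f g :: "int poly"
  assumes "\<And>i. i < m \<Longrightarrow> p dvd coeff f i" "\<And>i. i < e \<Longrightarrow> p dvd coeff g i"
  shows "p dvd coeff ([:0, 1:] * wronskian f g) (m + e) - (int m - int e) * (coeff f m * coeff g e)"
    and "i < m + e \<Longrightarrow> p dvd coeff ([:0, 1:] * wronskian f g) i"
proof -
  let ?D = "\<lambda>f. [:0, 1:] * pderiv f :: int poly"
  have eq: "[:0, 1:] * wronskian f g = ?D f * g - f * ?D g"
    by (simp add: wronskian_def algebra_simps)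
  have Df: "\<And>i. i < m \<Longrightarrow> p dvd coeff (?D f) i" and Dg: "\<And>i. i < e \<Longrightarrow> p dvd coeff (?D g) i"
    using assms by (simp_all only: coeff_theta dvd_mult)
  have a: "p dvd coeff (?D f * g) (m + e) - int m * coeff f m * coeff g e"
    using lowest_coeff_mult(1)[OF Df assms(2), of m e] by (simp only: coeff_theta)
  have b: "p dvd coeff (f * ?D g) (m + e) - coeff f m * (int e * coeff g e)"
    using lowest_coeff_mult(1)[OF assms(1) Dg, of m e] by (simp only: coeff_theta)
  show "p dvd coeff ([:0, 1:] * wronskian f g) (m + e) - (int m - int e) * (coeff f m * coeff g e)"
    unfolding eq coeff_diff using dvd_diff[OF a b] by (simp add: algebra_simps)
  assume "i < m + e"
  then show "p dvd coeff ([:0, 1:] * wronskian f g) i"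
    unfolding eq coeff_diff
    using lowest_coeff_mult(2)[OF Df assms(2), of m e i] lowest_coeff_mult(2)[OF assms(1) Dg, of m e i] by auto
qed

lemma wronskian_diff_smult: "wronskian (f - smult c g) g = wronskian f g"
  by (simp add: wronskian_def pderiv_diff pderiv_smult algebra_simps)

lemma prime_cancel_coeff:
  assumes "prime (p::int)" "\<not> p dvd a"
  obtains c where "p dvd b - c * a"
proof -
  have "coprime a p" using assms by (metis coprime_commute prime_imp_coprime)
  then obtain u where "[a * u = 1] (mod p)" using cong_solve_coprime_int by blast
  then have "p dvd 1 - a * u" by (simp add: cong_iff_dvd_diff dvd_diff_commute)
  then have "p dvd b * (1 - a * u)" by simp
  then have "p dvd b - (b * u) * a" by (simp add: algebra_simps)
  then show ?thesis using that by blast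
qed

lemma int_diff_not_dvd:
  assumes "m \<noteq> e" "int m < p" "int e < p"
  shows "\<not> p dvd int m - int e"
proof
  assume "p dvd int m - int e"
  then have "\<bar>p\<bar> \<le> \<bar>int m - int e\<bar>" using assms(1) by (intro dvd_imp_le_int) auto
  then show False using assms by linarith
qed

text \<open>A rational function f / g with zero derivative is a function of x^p; below degree p only scalars
remain. After a multiple of g is subtracted, the orders of f and g at 0 differ by less than p, and the
lowest coefficient of the Wronskian cannot vanish.\<close>

lemma wronskian_zero_imp_proportional:
  fixes f g :: "int poly"
  assumes p: "prime p" and deg: "int (degree f) < p" "int (degree g) < p"
    and g: "\<not> [:p:] dvd g" and w: "[:p:] dvd wronskian f g"
  obtains c where "[:p:] dvd f - smult c g"
proof -
  obtain e where e: "\<not> p dvd coeff g e" "\<And>i. i < e \<Longrightarrow> p dvd coeff g i" "e \<le> degree g"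
    using obtain_lowest_coeff[OF g] by blast
  obtain c where c: "p dvd coeff f e - c * coeff g e" using prime_cancel_coeff[OF p e(1)] .
  define h where "h = f - smult c g"
  have "[:p:] dvd h"
  proof (rule ccontr)
    assume "\<not> [:p:] dvd h"
    then obtain m where m: "\<not> p dvd coeff h m" "\<And>i. i < m \<Longrightarrow> p dvd coeff h i" "m \<le> degree h"
      using obtain_lowest_coeff by blast
    have "degree h \<le> max (degree f) (degree g)" unfolding h_def
      by (intro degree_diff_le) auto
    then have "int m < p" using m(3) deg by linarith
    moreover have "m \<noteq> e" using m(1) c by (auto simp: h_def)
    ultimately have nd: "\<not> p dvd int m - int e" using int_diff_not_dvd e(3) deg(2) by force
    have "[:p:] dvd [:0, 1:] * wronskian h g" using w by (simp only: h_def wronskian_diff_smult dvd_mult)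
    then have "p dvd coeff ([:0, 1:] * wronskian h g) (m + e)" by (simp only: const_poly_dvd_iff)
    with wronskian_lowest_coeff(1)[OF m(2) e(2), of m e]
    have "p dvd (int m - int e) * (coeff h m * coeff g e)" by (metis dvd_diff_right_iff dvd_diff_commute)
    then show False using nd m(1) e(1) p by (simp add: prime_dvd_mult_iff)
  qed
  then show ?thesis using that h_def by blast
qed

text \<open>The hypothesis says (f / g)' = a / (1 - x) + b / x modulo p, and a derivative has residue 0. Let
e be the order of g at 0. If p does not divide b, the right-hand side has order exactly 2 e. On the
left, f may be changed by a multiple of g so that its order m differs from e; then the left-hand side
has order exactly m + e.\<close>

lemma residue_at_0:
  fixes f g :: "int poly"
  assumes p: "prime p" and deg: "int (degree f) < p" "int (degree g) < p"
    and g: "\<not> [:p:] dvd g"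
    and w: "[:p:] dvd [:0, 1, -1:] * wronskian f g - g * g * (smult a [:0, 1:] + smult b [:1, -1:])"
  shows "p dvd b"
proof (rule ccontr)
  assume nb: "\<not> p dvd b"
  obtain e where e: "\<not> p dvd coeff g e" "\<And>i. i < e \<Longrightarrow> p dvd coeff g i" "e \<le> degree g"
    using obtain_lowest_coeff[OF g] by blast
  obtain c where c: "p dvd coeff f e - c * coeff g e" using prime_cancel_coeff[OF p e(1)] .
  define h where "h = f - smult c g"
  let ?R = "g * g * (smult a [:0, 1:] + smult b [:1, -1:])"
  let ?W = "[:0, 1:] * wronskian h g"
  have split: "[:0, 1, -1:] * wronskian f g = [:1, -1:] * ?W"
    by (simp add: h_def wronskian_diff_smult algebra_simps)
  have wi: "p dvd coeff ([:1, -1:] * ?W) i - coeff ?R i" for i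
    using w by (simp only: const_poly_dvd_iff coeff_diff split)
  have gg: "p dvd coeff (g * g) (e + e) - coeff g e * coeff g e" "\<And>i. i < e + e \<Longrightarrow> p dvd coeff (g * g) i"
    using lowest_coeff_mult[OF e(2) e(2)] by blast+
  have R: "p dvd coeff ?R (e + e) - coeff (g * g) (e + e) * b" "\<And>i. i < e + e \<Longrightarrow> p dvd coeff ?R i"
    using lowest_coeff_mult[where e=0 and f="g * g" and m="e+e" and p=p, OF gg(2), where g="smult a [:0, 1:] + smult b [:1, -1:]"] by auto
  have R': "\<not> p dvd coeff ?R (e + e)"
  proof
    assume "p dvd coeff ?R (e + e)"
    then have "p dvd coeff (g * g) (e + e) * b" using R(1) by (metis dvd_diff_right_iff dvd_diff_commute)
    then have "p dvd coeff (g * g) (e + e)" using nb p by (simp add: prime_dvd_mult_iff)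
    then have "p dvd coeff g e * coeff g e" using gg(1) by (metis dvd_diff_right_iff dvd_diff_commute)
    then show False using e(1) p by (simp add: prime_dvd_mult_iff)
  qed
  have nh: "\<not> [:p:] dvd h"
  proof
    assume "[:p:] dvd h"
    then have "[:p:] dvd wronskian h g" unfolding wronskian_def
      by (intro dvd_diff dvd_mult2 const_poly_dvd_pderiv)
    then have "[:p:] dvd [:1, -1:] * ?W" by (simp only: dvd_mult)
    then have "p dvd coeff ([:1, -1:] * ?W) (e + e)" by (simp only: const_poly_dvd_iff)
    then show False using wi[of "e+e"] R' by (metis dvd_diff_right_iff dvd_diff_commute)
  qed
  obtain m where m: "\<not> p dvd coeff h m" "\<And>i. i < m \<Longrightarrow> p dvd coeff h i" "m \<le> degree h"
    using obtain_lowest_coeff[OF nh] by blast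
  have "degree h \<le> max (degree f) (degree g)" unfolding h_def
    by (intro degree_diff_le) auto
  then have "int m < p" using m(3) deg by linarith
  moreover have me: "m \<noteq> e" using m(1) c by (auto simp: h_def)
  ultimately have nd: "\<not> p dvd int m - int e" using int_diff_not_dvd e(3) deg(2) by force
  note W = wronskian_lowest_coeff[OF m(2) e(2)]
  have W1: "\<not> p dvd coeff ?W (m + e)"
  proof
    assume "p dvd coeff ?W (m + e)"
    with W(1) have "p dvd (int m - int e) * (coeff h m * coeff g e)" by (metis dvd_diff_right_iff dvd_diff_commute)
    then show False using nd m(1) e(1) p by (simp add: prime_dvd_mult_iff)
  qed
  have Wl: "p dvd coeff ([:1, -1:] * ?W) (m + e) - 1 * coeff ?W (m + e)"
       "\<And>i. i < m + e \<Longrightarrow> p dvd coeff ([:1, -1:] * ?W) i"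
    using lowest_coeff_mult[where m=0 and f="[:1,-1:]" and g="?W" and e="m+e" and p=p] W(2) by auto
  show False
  proof (cases "m < e")
    case True
    then have "p dvd coeff ?R (m + e)" using R(2) by simp
    then have "p dvd coeff ([:1, -1:] * ?W) (m + e)" using wi[of "m+e"] by (metis dvd_diff_left_iff)
    then show False using Wl(1) W1 by (metis dvd_diff_right_iff mult_1)
  next
    case False
    then have "p dvd coeff ([:1, -1:] * ?W) (e + e)" using Wl(2) me by simp
    then show False using wi[of "e+e"] R' by (metis dvd_diff_right_iff)
  qed
qed

lemma const_poly_dvd_pcompose:
  assumes "[:p:] dvd f" shows "[:p:] dvd pcompose f (q::int poly)"
proof -
  obtain g where "f = [:p:] * g" using assms by (elim dvdE)
  then have "pcompose f q = [:p:] * pcompose g q" by (simp only: pcompose_mult pcompose_const)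
  then show ?thesis by (rule dvdI)
qed

text \<open>The substitution of 1 - x for x exchanges the poles 0 and 1.\<close>

lemma residue_at_1:
  fixes f g :: "int poly"
  assumes p: "prime p" and deg: "int (degree f) < p" "int (degree g) < p"
    and g: "\<not> [:p:] dvd g"
    and w: "[:p:] dvd [:0, 1, -1:] * wronskian f g - g * g * (smult a [:0, 1:] + smult b [:1, -1:])"
  shows "p dvd a"
proof -
  let ?s = "\<lambda>f. pcompose f [:1, -1:] :: int poly"
  have ss: "?s (?s f) = f" for f
    by (simp flip: pcompose_assoc add: pcompose_pCons pcompose_idR)
  have d: "degree (?s f) = degree f" for f by (simp add: degree_pcompose)
  have *: "\<not> [:p:] dvd ?s g" using const_poly_dvd_pcompose[of p "?s g" "[:1,-1:]"] g by (auto simp: ss)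
  have ws: "?s (wronskian f g) = - wronskian (?s f) (?s g)"
    by (simp add: wronskian_def pcompose_diff pcompose_mult pderiv_pcompose pderiv_pCons algebra_simps)
  have "[:p:] dvd ?s ([:0, 1, -1:] * wronskian f g - g * g * (smult a [:0, 1:] + smult b [:1, -1:]))"
    using w by (rule const_poly_dvd_pcompose)
  also have "?s ([:0, 1, -1:] * wronskian f g - g * g * (smult a [:0, 1:] + smult b [:1, -1:]))
    = ?s [:0, 1, -1:] * ?s (wronskian f g) - ?s g * ?s g * ?s (smult a [:0, 1:] + smult b [:1, -1:])"
    by (simp only: pcompose_diff pcompose_mult)
  also have "?s [:0, 1, -1:] = [:0, 1, -1:]"
    by (simp add: pcompose_pCons)
  also have "?s (smult a [:0, 1:] + smult b [:1, -1:]) = - (smult (-b) [:0, 1:] + smult (-a) [:1, -1:])"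
    by (simp add: pcompose_pCons)
  also have "[:0, 1, -1:] * ?s (wronskian f g) - ?s g * ?s g * - (smult (-b) [:0, 1:] + smult (-a) [:1, -1:])
    = - ([:0, 1, -1:] * wronskian (?s f) (?s g)
      - ?s g * ?s g * (smult (-b) [:0, 1:] + smult (-a) [:1, -1:]))"
    unfolding ws by (simp only: mult_minus_right minus_diff_eq diff_minus_eq_add minus_minus add.commute) 
  finally have "[:p:] dvd [:0, 1, -1:] * wronskian (?s f) (?s g)
      - ?s g * ?s g * (smult (-b) [:0, 1:] + smult (-a) [:1, -1:])" by (simp only: dvd_minus_iff)
  then have "p dvd - a" using residue_at_0[OF p, of "?s f" "?s g" "-b" "-a"] deg d * by simp
  then show ?thesis by simp
qed

section \<open>Siegel's lemma modulo a prime\<close>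

text \<open>Two vectors with entries in {0..<p} have the same image modulo p; their difference is a solution.
Stating this for additive maps, and not for matrices, allows conditions that are not written out as
linear forms.\<close>

lemma additive_pigeonhole_mod:
  fixes Phi :: "('x \<Rightarrow> int) \<Rightarrow> 'y \<Rightarrow> int"
  assumes fin: "finite X" "finite Y" and card: "card Y < card X" and p: "p > 1"
    and diff: "\<And>a b y. y \<in> Y \<Longrightarrow> Phi (\<lambda>x. a x - b x) y = Phi a y - Phi b y"
  obtains a where "\<exists>x\<in>X. \<not> p dvd a x" "\<And>y. y \<in> Y \<Longrightarrow> p dvd Phi a y"
proof -
  let ?S = "X \<rightarrow>\<^sub>E {0..<p}" and ?T = "Y \<rightarrow>\<^sub>E {0..<p}"
  let ?F = "\<lambda>a. restrict (\<lambda>y. Phi a y mod p) Y"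
  have "?F ` ?S \<subseteq> ?T" using p by auto
  moreover have "finite ?T" using fin by (intro finite_PiE) auto
  ultimately have "card (?F ` ?S) \<le> card ?T" by (rule card_mono[rotated])
  also have "card ?T = nat p ^ card Y" using fin by (simp add: card_PiE)
  also have "\<dots> < nat p ^ card X" using card p by (intro power_strict_increasing) auto
  also have "\<dots> = card ?S" using fin by (simp add: card_PiE)
  finally have "\<not> inj_on ?F ?S" by (rule pigeonhole)
  then obtain a b where ab: "a \<in> ?S" "b \<in> ?S" "a \<noteq> b" "?F a = ?F b" by (auto simp: inj_on_def)
  obtain x where x: "x \<in> X" "a x \<noteq> b x" using ab(1-3) by (metis PiE_ext)
  have "a x \<in> {0..<p}" "b x \<in> {0..<p}" using ab x by auto
  then have "\<not> p dvd a x - b x"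
    using x dvd_imp_le_int[of "a x - b x" p] by auto
  moreover have "p dvd Phi (\<lambda>x. a x - b x) y" if "y \<in> Y" for y
  proof -
    have "Phi a y mod p = Phi b y mod p" using ab(4) that by (metis restrict_apply')
    then show ?thesis by (simp add: diff[OF that] mod_eq_dvd_iff)
  qed
  ultimately show ?thesis using x that[of "\<lambda>x. a x - b x"] by blast
qed

text \<open>Each equation between polynomials of degree less than H + E amounts to H + E linear conditions on the
H coefficients of each unknown.\<close>

lemma siegel_poly_mod:
  fixes A :: "'i \<Rightarrow> 'j \<Rightarrow> int poly"
  assumes fin: "finite I" "finite J" and card: "card I * (H + E) < card J * H"
    and deg: "\<And>i j. i \<in> I \<Longrightarrow> j \<in> J \<Longrightarrow> degree (A i j) \<le> E" and p: "p > 1"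
  obtains q where "\<exists>j\<in>J. \<not> [:p:] dvd q j" "\<And>j. degree (q j) < H"
    "\<And>i. i \<in> I \<Longrightarrow> [:p:] dvd (\<Sum>j\<in>J. A i j * q j)"
proof -
  define q where "q = (\<lambda>(a :: 'j \<times> nat \<Rightarrow> int) j. \<Sum>h<H. monom (a (j, h)) h)"
  have qdiff: "q (\<lambda>x. a x - b x) j = q a j - q b j" for a b j
    by (simp add: q_def sum_subtractf flip: diff_monom)
  have H: "H > 0" using card by (cases H) auto
  have qdeg: "degree (q a j) < H" for a j
    unfolding q_def
    by (rule degree_lessI) (use H in \<open>auto simp: coeff_sum\<close>)
  have qcoeff: "coeff (q a j) h = a (j, h)" if "h < H" for a j h
    using that by (simp add: q_def coeff_sum)
  define Phi where "Phi = (\<lambda>a y. coeff (\<Sum>j\<in>J. A (fst y) j * q a j) (snd y))"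
  have diff: "Phi (\<lambda>x. a x - b x) y = Phi a y - Phi b y" if "y \<in> I \<times> {..<H + E}" for a b y
    by (simp add: Phi_def qdiff right_diff_distrib sum_subtractf)
  have "card (I \<times> {..<H + E}) < card (J \<times> {..<H})"
    using card by (simp add: card_cartesian_product)
  moreover have "finite (J \<times> {..<H})" "finite (I \<times> {..<H + E})" using fin by auto
  ultimately obtain a where a: "\<exists>x\<in>J \<times> {..<H}. \<not> p dvd a x"
    "\<And>y. y \<in> I \<times> {..<H + E} \<Longrightarrow> p dvd Phi a y"
    using additive_pigeonhole_mod[where Phi = Phi, OF _ _ _ p diff] by metis
  show ?thesis
  proof (rule that[of "q a"])
    obtain j h where jh: "j \<in> J" "h < H" "\<not> p dvd a (j, h)" using a(1) by auto
    then have "\<not> [:p:] dvd q a j" by (metis const_poly_dvd_iff qcoeff)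
    then show "\<exists>j\<in>J. \<not> [:p:] dvd q a j" using jh by blast
    show "degree (q a j) < H" for j by (rule qdeg)
    fix i assume i: "i \<in> I"
    show "[:p:] dvd (\<Sum>j\<in>J. A i j * q a j)"
      unfolding const_poly_dvd_iff
    proof
      fix e
      show "p dvd coeff (\<Sum>j\<in>J. A i j * q a j) e"
      proof (cases "e < H + E")
        case True
        then show ?thesis using a(2)[of "(i, e)"] i by (simp add: Phi_def)
      next
        case False
        have "degree (A i j * q a j) < e" if "j \<in> J" for j
          using degree_mult_le[of "A i j" "q a j"] deg[OF i that] qdeg[of a j] False by linarith
        then have "coeff (\<Sum>j\<in>J. A i j * q a j) e = 0"
          unfolding coeff_sum by (intro sum.neutral) (auto simp: coeff_eq_0)
        then show ?thesis by simp
      qed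
    qed
  qed
qed

section \<open>Connections on vectors of polynomials\<close>

text \<open>The factor x (1 - x) clears the denominators x and 1 - x that occur when polylogarithms are
differentiated.\<close>

definition euler :: "int poly \<Rightarrow> int poly" where
  "euler f = [:0, 1, -1:] * pderiv f"

lemma euler_add: "euler (f + g) = euler f + euler g"
  by (simp add: euler_def pderiv_add algebra_simps)

lemma euler_diff: "euler (f - g) = euler f - euler g"
  by (simp add: euler_def pderiv_diff algebra_simps)

lemma euler_mult: "euler (f * g) = euler f * g + f * euler g"
  by (simp add: euler_def pderiv_mult algebra_simps)

lemma euler_0 [simp]: "euler 0 = 0"
  by (simp add: euler_def)

lemma euler_sum: "euler (sum f A) = (\<Sum>x\<in>A. euler (f x))"
  by (induction A rule: infinite_finite_induct) (auto simp: euler_add)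

lemma degree_euler_le: "degree (euler f) \<le> degree f + 1"
proof (cases "degree f = 0")
  case True
  then have "pderiv f = 0" by (simp add: pderiv_eq_0_iff)
  then show ?thesis by (simp add: euler_def)
next
  case False
  have "degree (euler f) \<le> degree [:0, 1, -1::int:] + degree (pderiv f)"
    unfolding euler_def by (rule degree_mult_le)
  also have "\<dots> = degree f + 1" using False by (simp add: degree_pderiv)
  finally show ?thesis .
qed

lemma const_poly_dvd_euler: "[:p:] dvd f \<Longrightarrow> [:p:] dvd euler f"
  unfolding euler_def by (intro dvd_mult const_poly_dvd_pderiv)

text \<open>If a family f satisfies E (f c) = sum of K c d * f d, then E applied to the combination
sum of w c * f c is the combination with coefficients connection I K w.\<close>

definition connection :: "'c set \<Rightarrow> ('c \<Rightarrow> 'c \<Rightarrow> int poly) \<Rightarrow> ('c \<Rightarrow> int poly) \<Rightarrow> 'c \<Rightarrow> int poly" where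
  "connection I K w d = euler (w d) + (\<Sum>c\<in>I. w c * K c d)"

lemma connection_sum_mult:
  "connection I K (\<lambda>c. \<Sum>i\<in>S. q i * v i c) d =
    (\<Sum>i\<in>S. euler (q i) * v i d + q i * connection I K (v i) d)"
proof -
  have "(\<Sum>c\<in>I. (\<Sum>i\<in>S. q i * v i c) * K c d) = (\<Sum>i\<in>S. q i * (\<Sum>c\<in>I. v i c * K c d))"
    by (simp add: sum_distrib_left sum_distrib_right mult.assoc sum.swap[of _ I S])
  then show ?thesis
    by (simp add: connection_def euler_sum euler_mult sum.distrib algebra_simps)
qed

lemma degree_connection_le:
  assumes "\<And>c. c \<in> I \<Longrightarrow> degree (w c) \<le> A" "d \<in> I" "\<And>c d. degree (K c d) \<le> 1"
  shows "degree (connection I K w d) \<le> A + 1"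
proof (cases "finite I")
  case True
  have "degree (w c * K c d) \<le> A + 1" if "c \<in> I" for c
    using degree_mult_le[of "w c" "K c d"] assms(1)[OF that] assms(3)[of c d] by linarith
  then have "degree (\<Sum>c\<in>I. w c * K c d) \<le> A + 1" by (intro degree_sum_le True) auto
  moreover have "degree (euler (w d)) \<le> A + 1"
    using degree_euler_le[of "w d"] assms(1)[OF assms(2)] by linarith
  ultimately show ?thesis unfolding connection_def by (rule degree_add_le[rotated])
next
  case False
  then show ?thesis using degree_euler_le[of "w d"] assms(1)[OF assms(2)] by (simp add: connection_def)
qed

lemma degree_connection_funpow_le:
  assumes "\<And>c. c \<in> I \<Longrightarrow> degree (w c) \<le> A" "\<And>c d. degree (K c d) \<le> 1" "d \<in> I"
  shows "degree ((connection I K ^^ i) w d) \<le> A + i"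
  using assms(3)
proof (induction i arbitrary: d)
  case 0
  then show ?case using assms(1) by simp
next
  case (Suc i)
  then show ?case using degree_connection_le[of I "(connection I K ^^ i) w" "A + i" d K] assms(2) by simp
qed

section \<open>Horizontal vectors of a triangular connection\<close>

lemma max_rank_nonzero:
  assumes "finite I" "c \<in> I" "\<not> [:p:] dvd w c"
  obtains t where "t \<in> I" "\<not> [:p:] dvd (w t :: int poly)"
    "\<And>c. c \<in> I \<Longrightarrow> (\<rho> t :: nat) < \<rho> c \<Longrightarrow> [:p:] dvd w c" "\<rho> c \<le> \<rho> t"
proof -
  let ?S = "{c \<in> I. \<not> [:p:] dvd w c}"
  have S: "finite (\<rho> ` ?S)" "\<rho> ` ?S \<noteq> {}" using assms by auto
  then obtain t where t: "t \<in> ?S" "\<rho> t = Max (\<rho> ` ?S)" using Max_in by (metis (no_types, lifting) imageE)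
  have "\<rho> c \<le> \<rho> t" if "c \<in> ?S" for c using that t S(1) by simp
  then show ?thesis using that[of t] t assms by (metis (mono_tags, lifting) leD mem_Collect_eq)
qed

text \<open>Let D be the connection and l the largest number such that v, Dv, ..., D^(l-1) v are independent modulo
p, so that their span is stable under D up to scaling. At most l indices occur as the position of the
highest nonzero entry of a vector in the span, because vectors with distinct top positions are
independent.
By Siegel's lemma some nonzero w in the span has zero entries at all these positions except the lowest
one, t; so t is its top position. Since D is triangular, w_t Dw - E(w_t) w lies in the span, up to
scaling, and its entries are zero from t upwards. So it is zero, by the choice of t. Siegel's lemma, and
not elimination, is what keeps the degree of w polynomial in n.\<close>

lemma exists_horizontal_up_to_scaling:
  fixes p :: int and I :: "'c set" and K :: "'c \<Rightarrow> 'c \<Rightarrow> int poly" and \<rho> :: "'c \<Rightarrow> nat"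
    and v :: "'c \<Rightarrow> int poly"
  defines "n \<equiv> card I"
  assumes p: "prime p" and fin: "finite I" and inj: "inj_on \<rho> I"
    and degK: "\<And>c d. degree (K c d) \<le> 1"
    and lower: "\<And>c d. c \<in> I \<Longrightarrow> d \<in> I \<Longrightarrow> K c d \<noteq> 0 \<Longrightarrow> \<rho> d < \<rho> c"
    and degv: "\<And>c. c \<in> I \<Longrightarrow> degree (v c) \<le> A"
    and nz: "\<exists>c\<in>I. \<not> [:p:] dvd v c"
  obtains q w t where "w = (\<lambda>c. \<Sum>i<n. q i * (connection I K ^^ i) v c)" "t \<in> I" "\<not> [:p:] dvd w t"
    "\<And>c. c \<in> I \<Longrightarrow> \<rho> t < \<rho> c \<Longrightarrow> [:p:] dvd w c"
    "\<And>c. c \<in> I \<Longrightarrow> degree (w c) \<le> (n + 1) * (A + n)"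
    "\<And>d. d \<in> I \<Longrightarrow> [:p:] dvd w t * connection I K w d - euler (w t) * w d"
proof -
  have p1: "p > 1" using p by (simp add: prime_gt_1_int)
  define V where "V = (\<lambda>i. (connection I K ^^ i) v)"
  have VSuc: "connection I K (V i) = V (Suc i)" for i by (simp add: V_def)
  have degV: "degree (V i c) \<le> A + i" if "c \<in> I" for i c
    unfolding V_def using degree_connection_funpow_le[where w = v and I = I and K = K] degv degK that by blast
  define dep where "dep = (\<lambda>m. \<exists>q. (\<exists>i<m. \<not> [:p:] dvd q i) \<and> (\<forall>c\<in>I. [:p:] dvd (\<Sum>i<m. V i c * q i)))"
  have "dep (n + 1)"
  proof -
    let ?H = "n * (A + n) + 1"
    have card: "card I * (?H + (A + n)) < card {..<n+1} * ?H"
      by (simp add: n_def algebra_simps)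
    obtain q where "\<exists>i\<in>{..<n+1}. \<not> [:p:] dvd q i" "\<And>c. c \<in> I \<Longrightarrow> [:p:] dvd (\<Sum>i<n+1. V i c * q i)"
    proof (rule siegel_poly_mod[OF fin _ card, where A = "\<lambda>c i. V i c" and p = p])
      fix c i assume "c \<in> I" "i \<in> {..<n+1}"
      then show "degree (V i c) \<le> A + n" using degV[of c i] by auto
    qed (use p1 in auto)
    then show ?thesis unfolding dep_def by blast
  qed
  moreover have "\<not> dep 0" by (simp add: dep_def)
  moreover define l where "l = (LEAST m. dep (Suc m))"
  ultimately have depl: "dep (Suc l)" and l_le: "l \<le> n" and "\<forall>m<l. \<not> dep (Suc m)"
    unfolding l_def by (auto intro: LeastI Least_le dest: not_less_Least)
  with \<open>\<not> dep 0\<close> have ndep: "\<not> dep l" by (cases l) auto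
  have l0: "l > 0"
  proof (rule ccontr)
    assume "\<not> l > 0"
    then have "dep 1" using depl by simp
    then obtain q where q: "\<not> [:p:] dvd q 0" "\<forall>c\<in>I. [:p:] dvd v c * q 0"
      unfolding dep_def V_def by auto
    then show False using nz prime_const_poly_dvd_mult_iff[OF p] by blast
  qed
  obtain r where r: "\<exists>i<Suc l. \<not> [:p:] dvd r i" "\<And>c. c \<in> I \<Longrightarrow> [:p:] dvd (\<Sum>i<Suc l. V i c * r i)"
    using depl unfolding dep_def by blast
  have rl: "\<not> [:p:] dvd r l"
  proof
    assume rl: "[:p:] dvd r l"
    then have "\<exists>i<l. \<not> [:p:] dvd r i" using r(1) by (metis less_SucE)
    moreover have "[:p:] dvd (\<Sum>i<l. V i c * r i)" if "c \<in> I" for c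
      using r(2)[OF that] rl by (simp add: dvd_add_left_iff)
    ultimately show False using ndep unfolding dep_def by blast
  qed
  define comb where "comb = (\<lambda>q c. \<Sum>i<l. V i c * q i)"
  have comb_apply: "comb q c = (\<Sum>i<l. V i c * q i)" for q c by (simp add: comb_def)
  define Top where "Top = {t \<in> I. \<exists>q. \<not> [:p:] dvd comb q t \<and> (\<forall>c\<in>I. \<rho> t < \<rho> c \<longrightarrow> [:p:] dvd comb q c)}"
  have TopI: "\<exists>t\<in>Top. \<not> [:p:] dvd comb q t \<and> (\<forall>c\<in>I. \<rho> t < \<rho> c \<longrightarrow> [:p:] dvd comb q c)"
    if "c \<in> I" "\<not> [:p:] dvd comb q c" for q c
    using max_rank_nonzero[OF fin that(1), where \<rho> = \<rho> and w = "comb q" and p = p, OF that(2)]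
    by (smt (verit, best) Top_def mem_Collect_eq)
  have finTop: "finite Top" and TopsubI: "Top \<subseteq> I" using fin by (auto simp: Top_def)
  have "card Top \<le> l"
  proof (rule ccontr)
    assume "\<not> card Top \<le> l"
    have "\<forall>t\<in>Top. \<exists>q. \<not> [:p:] dvd comb q t \<and> (\<forall>c\<in>I. \<rho> t < \<rho> c \<longrightarrow> [:p:] dvd comb q c)"
      unfolding Top_def by blast
    then obtain Q where Q: "\<And>t. t \<in> Top \<Longrightarrow> \<not> [:p:] dvd comb (Q t) t"
      "\<And>t c. t \<in> Top \<Longrightarrow> c \<in> I \<Longrightarrow> \<rho> t < \<rho> c \<Longrightarrow> [:p:] dvd comb (Q t) c"
      by (metis bchoice)
    define E where "E = Max (insert 0 ((\<lambda>(i, t). degree (Q t i)) ` ({..<l} \<times> Top)))"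
    have E: "degree (Q t i) \<le> E" if "i < l" "t \<in> Top" for i t
      unfolding E_def using that finTop by (intro Max_ge) auto
    let ?H = "l * E + 1"
    have "card {..<l} * (?H + E) < (l + 1) * ?H" by (simp add: algebra_simps)
    also have "\<dots> \<le> card Top * ?H" using \<open>\<not> card Top \<le> l\<close> by (intro mult_right_mono) auto
    finally have card: "card {..<l} * (?H + E) < card Top * ?H" .
    obtain z where z: "\<exists>t\<in>Top. \<not> [:p:] dvd z t" "\<And>i. i \<in> {..<l} \<Longrightarrow> [:p:] dvd (\<Sum>t\<in>Top. Q t i * z t)"
    proof (rule siegel_poly_mod[OF _ finTop card, where A = "\<lambda>i t. Q t i" and p = p])
      fix i t assume "i \<in> {..<l}" "t \<in> Top"
      then show "degree (Q t i) \<le> E" using E by simp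
    qed (use p1 in auto)
    obtain \<tau> where tau: "\<tau> \<in> Top" "\<not> [:p:] dvd z \<tau>" "\<And>t. t \<in> Top \<Longrightarrow> \<rho> \<tau> < \<rho> t \<Longrightarrow> [:p:] dvd z t"
      using z(1) max_rank_nonzero[OF finTop, where w = z and \<rho> = \<rho> and p = p] by (metis (no_types, lifting))
    have "(\<Sum>t\<in>Top. z t * comb (Q t) \<tau>) = (\<Sum>i<l. V i \<tau> * (\<Sum>t\<in>Top. Q t i * z t))"
      by (simp add: comb_def sum_distrib_left sum.swap[of _ Top] mult_ac)
    then have "[:p:] dvd (\<Sum>t\<in>Top. z t * comb (Q t) \<tau>)"
      using z(2) by (auto intro!: dvd_sum)
    moreover have "[:p:] dvd (\<Sum>t\<in>Top - {\<tau>}. z t * comb (Q t) \<tau>)"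
    proof (rule dvd_sum)
      fix t assume t: "t \<in> Top - {\<tau>}"
      then have "\<rho> t \<noteq> \<rho> \<tau>" using inj tau(1) TopsubI by (auto simp: inj_on_def)
      then have "[:p:] dvd z t \<or> [:p:] dvd comb (Q t) \<tau>"
        using tau Q(2) t TopsubI by (metis DiffD1 linorder_neqE_nat subsetD)
      then show "[:p:] dvd z t * comb (Q t) \<tau>" by auto
    qed
    ultimately have "[:p:] dvd z \<tau> * comb (Q \<tau>) \<tau>"
      using tau(1) finTop by (simp add: sum.remove[of Top \<tau>] dvd_add_left_iff)
    then show False using tau Q(1) prime_const_poly_dvd_mult_iff[OF p] by blast
  qed
  have "Top \<noteq> {}"
  proof -
    let ?q = "\<lambda>i::nat. if i = 0 then 1 else 0"
    have "comb ?q = v" using l0 by (auto simp: comb_def V_def if_distrib sum.delta cong: if_cong)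
    then show ?thesis using nz TopI[where q = ?q] by auto
  qed
  then obtain t where t: "t \<in> Top" "\<And>c. c \<in> Top \<Longrightarrow> \<rho> t \<le> \<rho> c"
    using finTop by (metis arg_min_if_finite(1) arg_min_least)
  let ?H = "l * (A + n) + 1"
  have "card (Top - {t}) \<le> l - 1" using \<open>card Top \<le> l\<close> t(1) finTop by simp
  then have "card (Top - {t}) * (?H + (A + n)) \<le> (l - 1) * (?H + (A + n))" by (rule mult_right_mono) simp
  also have "\<dots> < l * ?H" using l0 by (cases l) (auto simp: algebra_simps)
  finally have card: "card (Top - {t}) * (?H + (A + n)) < card {..<l} * ?H" by simp
  obtain q where q: "\<exists>i\<in>{..<l}. \<not> [:p:] dvd q i" "\<And>i. degree (q i) < ?H"
     "\<And>c. c \<in> Top - {t} \<Longrightarrow> [:p:] dvd (\<Sum>i<l. V i c * q i)"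
  proof (rule siegel_poly_mod[OF _ _ card, where A = "\<lambda>c i. V i c" and p = p])
    fix c i assume "c \<in> Top - {t}" "i \<in> {..<l}"
    then show "degree (V i c) \<le> A + n" using degV[of c i] TopsubI l_le by fastforce
  qed (use finTop p1 in auto)
  obtain c0 where c0: "c0 \<in> I" "\<not> [:p:] dvd comb q c0"
    using ndep q(1) unfolding dep_def comb_def by blast
  have wt: "\<not> [:p:] dvd comb q t" and wtop: "\<And>c. c \<in> I \<Longrightarrow> \<rho> t < \<rho> c \<Longrightarrow> [:p:] dvd comb q c"
    using TopI[OF c0] q(3) unfolding comb_def by blast+
  have tI: "t \<in> I" using t TopsubI by auto
  have wdeg: "degree (comb q c) \<le> (n + 1) * (A + n)" if "c \<in> I" for c
    unfolding comb_def
  proof (rule degree_sum_le)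
    fix i assume "i \<in> {..<l}"
    then have "degree (V i c) \<le> A + n" using degV[OF that, of i] l_le by auto
    moreover have "degree (q i) \<le> n * (A + n)"
      using q(2)[of i] l_le mult_right_mono[of l n "A + n"] by linarith
    ultimately show "degree (V i c * q i) \<le> (n + 1) * (A + n)"
      using degree_mult_le[of "V i c" "q i"] by (simp add: algebra_simps)
  qed simp
  define u where "u = (\<lambda>d. comb q t * connection I K (comb q) d - euler (comb q t) * comb q d)"
  have conn: "connection I K (comb q) d = (\<Sum>i<l. euler (q i) * V i d + q i * V (Suc i) d)" for d
    using connection_sum_mult[where I = I and K = K and v = V and q = q and S = "{..<l}" and d = d] by (simp add: comb_def VSuc mult.commute)
  have hor: "[:p:] dvd u d" if dI: "d \<in> I" for d
  proof (rule ccontr)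
    assume nu: "\<not> [:p:] dvd u d"
    \<comment> \<open>D shifts the coefficients q i of the powers D^i v by one. The term with D^l v that arises is removed
      by means of the relation r, after multiplication by r l.\<close>
    define q' where "q' = (\<lambda>i. case i of 0 \<Rightarrow> 0 | Suc j \<Rightarrow> q j)"
    define s where "s = (\<lambda>i. r l * comb q t * (euler (q i) + q' i) - comb q t * q (l - 1) * r i
        - r l * euler (comb q t) * q i)"
    have shift: "(\<Sum>i<l. q i * V (Suc i) d) = (\<Sum>i<l. q' i * V i d) + q (l - 1) * V l d" for d
    proof -
      have "(\<Sum>i<Suc l. q' i * V i d) = (\<Sum>i<l. q i * V (Suc i) d)"
        unfolding sum.lessThan_Suc_shift by (simp add: q'_def)
      then show ?thesis using l0 by (cases l) (simp_all add: q'_def)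
    qed
    have us: "[:p:] dvd r l * u c - comb s c" if "c \<in> I" for c
    proof -
      have "comb s c = r l * comb q t * ((\<Sum>i<l. euler (q i) * V i c) + (\<Sum>i<l. q' i * V i c))
          - comb q t * q (l - 1) * (\<Sum>i<l. V i c * r i) - r l * euler (comb q t) * comb q c"
        unfolding comb_apply[of s c] comb_apply[of q c]
        by (simp add: s_def sum_distrib_left sum.distrib sum_subtractf algebra_simps)
      moreover have "r l * u c = r l * comb q t * ((\<Sum>i<l. euler (q i) * V i c) + (\<Sum>i<l. q' i * V i c))
          + comb q t * q (l - 1) * (V l c * r l) - r l * euler (comb q t) * comb q c"
        by (simp add: u_def conn sum.distrib shift algebra_simps)
      ultimately have "r l * u c - comb s c = comb q t * q (l - 1) * (\<Sum>i<Suc l. V i c * r i)"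
        by (simp add: algebra_simps)
      then show ?thesis using r(2)[OF that] by simp
    qed
    have "\<not> [:p:] dvd r l * u d" using rl nu prime_const_poly_dvd_mult_iff[OF p] by blast
    then have "\<not> [:p:] dvd comb s d" using us[OF dI] by (metis dvd_diff_left_iff)
    then obtain \<tau> where tau: "\<tau> \<in> Top" "\<not> [:p:] dvd comb s \<tau>" using TopI[OF dI] by blast
    have tauI: "\<tau> \<in> I" using tau TopsubI by auto
    have le: "\<rho> t \<le> \<rho> \<tau>" using t(2) tau(1) by simp
    have "[:p:] dvd (\<Sum>c\<in>I. comb q c * K c \<tau>)"
    proof (rule dvd_sum)
      fix c assume c: "c \<in> I"
      show "[:p:] dvd comb q c * K c \<tau>"
      proof (cases "K c \<tau> = 0")
        case False
        then have "\<rho> t < \<rho> c" using lower[OF c tauI] le by simp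
        then show ?thesis using wtop[OF c] by simp
      qed simp
    qed
    moreover have "u \<tau> = comb q t * (\<Sum>c\<in>I. comb q c * K c \<tau>)
        + (comb q t * euler (comb q \<tau>) - euler (comb q t) * comb q \<tau>)"
      by (simp add: u_def connection_def algebra_simps)
    moreover have "[:p:] dvd comb q t * euler (comb q \<tau>) - euler (comb q t) * comb q \<tau>"
    proof (cases "\<rho> \<tau> = \<rho> t")
      case True
      then have "\<tau> = t" using inj tauI tI by (auto simp: inj_on_def)
      then show ?thesis by simp
    next
      case False
      then have "[:p:] dvd comb q \<tau>" using le wtop[OF tauI] by simp
      then show ?thesis by (intro dvd_diff dvd_mult const_poly_dvd_euler)
    qed
    ultimately have "[:p:] dvd u \<tau>" by (simp add: dvd_add)
    then have "[:p:] dvd comb s \<tau>" using us[OF tauI] by (metis dvd_diff_right_iff dvd_mult)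
    then show False using tau(2) by simp
  qed
  define q0 where "q0 = (\<lambda>i. if i < l then q i else 0)"
  have "comb q = (\<lambda>c. \<Sum>i<n. q0 i * (connection I K ^^ i) v c)"
  proof
    fix c
    have "(\<Sum>i<n. q0 i * (connection I K ^^ i) v c) = (\<Sum>i<l. q0 i * (connection I K ^^ i) v c)"
      using l_le by (intro sum.mono_neutral_right) (auto simp: q0_def)
    then show "comb q c = (\<Sum>i<n. q0 i * (connection I K ^^ i) v c)"
      by (simp add: comb_def V_def q0_def mult.commute)
  qed
  then show ?thesis
    using that tI wt wtop wdeg hor unfolding u_def by blast
qed

section \<open>Monomials in the polylogarithms\<close>

text \<open>Variable 0 only makes monomials homogeneous and is given the value 1. So these exponents stand for the
monomials of degree at most C in the variables 1, ..., k.\<close>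

definition exponents :: "nat \<Rightarrow> nat \<Rightarrow> (nat \<Rightarrow> nat) set" where
  "exponents k C = {c. (\<forall>j>k. c j = 0) \<and> (\<Sum>j\<le>k. c j) = C}"

text \<open>The effect of E on one factor of a monomial, as E maps variable j to a multiple of variable j - 1.\<close>

definition shift_down :: "nat \<Rightarrow> (nat \<Rightarrow> nat) \<Rightarrow> nat \<Rightarrow> nat" where
  "shift_down j c = c(j := c j - 1, j - 1 := c (j - 1) + 1)"

text \<open>The matrix of E on monomials, if E sends variable 1 to z times variable 0 and variable j > 1 to 1 - x
times variable j - 1. The parameter z is x - x^p for the polylogarithms themselves; modulo x^p it may be
replaced by x, which keeps degrees small.\<close>

definition polylog_matrix :: "int poly \<Rightarrow> nat \<Rightarrow> (nat \<Rightarrow> nat) \<Rightarrow> (nat \<Rightarrow> nat) \<Rightarrow> int poly" where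
  "polylog_matrix z k c d = (\<Sum>j=1..k. if 0 < c j \<and> d = shift_down j c
     then smult (int (c j)) (if j = 1 then z else [:1, -1:]) else 0)"

lemma exponents_le: "c \<in> exponents k C \<Longrightarrow> c j \<le> C"
  unfolding exponents_def
  by (cases "j \<le> k") (auto intro!: member_le_sum)

lemma exponents_subset_functions:
  "exponents k C \<subseteq> (\<lambda>f j. if j \<le> k then f j else 0) ` ({..k} \<rightarrow>\<^sub>E {..C})"
proof
  fix c assume c: "c \<in> exponents k C"
  then have "c = (\<lambda>j. if j \<le> k then restrict c {..k} j else 0)"
    by (auto simp: exponents_def fun_eq_iff)
  moreover have "restrict c {..k} \<in> {..k} \<rightarrow>\<^sub>E {..C}" using exponents_le[OF c] by auto
  ultimately show "c \<in> (\<lambda>f j. if j \<le> k then f j else 0) ` ({..k} \<rightarrow>\<^sub>E {..C})" by blast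
qed

lemma finite_exponents: "finite (exponents k C)"
  by (rule finite_subset[OF exponents_subset_functions]) (intro finite_imageI finite_PiE; simp)

lemma card_exponents_le: "card (exponents k C) \<le> (C + 1) ^ (k + 1)"
proof -
  have fin: "finite ({..k} \<rightarrow>\<^sub>E {..C})" by (intro finite_PiE) auto
  have "card (exponents k C) \<le> card ((\<lambda>f j. if j \<le> k then f j else 0) ` ({..k} \<rightarrow>\<^sub>E {..C}))"
    by (intro card_mono finite_imageI fin exponents_subset_functions)
  also have "\<dots> \<le> card ({..k} \<rightarrow>\<^sub>E {..C})" by (rule card_image_le[OF fin])
  finally show ?thesis by (simp add: card_PiE)
qed

lemma card_exponents: "card (exponents k C) = (C + k) choose k"
proof -
  have "bij_betw (\<lambda>c. map c [0..<k + 1]) (exponents k C) {l. length l = k + 1 \<and> sum_list l = C}"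
  proof (rule bij_betwI[where g = "\<lambda>l j. if j \<le> k then l ! j else 0"])
    show "(\<lambda>c. map c [0..<k + 1]) \<in> exponents k C \<rightarrow> {l. length l = k + 1 \<and> sum_list l = C}"
      by (auto simp: exponents_def sum_list_sum_nth atLeast0LessThan lessThan_Suc_atMost simp del: upt_Suc)
    show "(\<lambda>l j. if j \<le> k then l ! j else 0) \<in> {l. length l = k + 1 \<and> sum_list l = C} \<rightarrow> exponents k C"
      by (auto simp: exponents_def sum_list_sum_nth atLeast0LessThan lessThan_Suc_atMost)
    show "(\<lambda>j. if j \<le> k then map c [0..<k + 1] ! j else 0) = c" if "c \<in> exponents k C" for c
      using that by (auto simp: exponents_def fun_eq_iff simp del: upt_Suc)
    show "map (\<lambda>j. if j \<le> k then l ! j else 0) [0..<k + 1] = l"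
      if "l \<in> {l. length l = k + 1 \<and> sum_list l = C}" for l
      using that by (auto intro!: nth_equalityI simp del: upt_Suc)
  qed
  then have "card (exponents k C) = (C + (k + 1) - 1) choose C"
    using card_length_sum_list[of "k + 1" C] by (simp only: bij_betw_same_card)
  then show ?thesis using binomial_symmetric[of k "C + k"] by simp
qed

text \<open>The exponent vectors with c k = 0 are those of k - 1 variables, and
k * binomial(C + k, k) = (C + k) * binomial(C + k - 1, k - 1).\<close>

lemma card_exponents_ratio:
  assumes "k \<ge> 1"
  shows "C * card {c \<in> exponents k C. c k = 0} \<le> k * card (exponents k C)"
proof -
  obtain i where i: "k = Suc i" using assms by (cases k) auto
  have "{c \<in> exponents k C. c k = 0} = exponents i C"
    unfolding i exponents_def by (auto simp: less_Suc_eq) (metis Suc_lessI)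
  moreover have "k * card (exponents k C) = (C + k) * card (exponents i C)"
    unfolding card_exponents i using Suc_times_binomial[of i "C + i"] by simp
  ultimately show ?thesis by simp
qed

lemma sum_shift_down:
  fixes a :: "nat \<Rightarrow> nat"
  assumes "1 \<le> j" "j \<le> k" "0 < c j"
  shows "(\<Sum>i\<le>k. a i * shift_down j c i) + a j = (\<Sum>i\<le>k. a i * c i) + a (j - 1)"
proof -
  have "shift_down j c i + of_bool (i = j) = c i + of_bool (i = j - 1)" for i
    using assms by (auto simp: shift_down_def)
  then have "(\<Sum>i\<le>k. a i * (shift_down j c i + of_bool (i = j))) = (\<Sum>i\<le>k. a i * (c i + of_bool (i = j - 1)))"
    by simp
  moreover have "(\<Sum>i\<le>k. a i * of_bool (i = m)) = a m" if "m \<le> k" for m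
  proof -
    have "(\<Sum>i\<le>k. a i * of_bool (i = m)) = (\<Sum>i\<le>k. if i = m then a i else 0)"
      by (intro sum.cong) auto
    then show ?thesis using that by simp
  qed
  ultimately show ?thesis using assms(1,2) by (simp add: distrib_left sum.distrib)
qed

lemma shift_down_in_exponents:
  assumes "c \<in> exponents k C" "1 \<le> j" "j \<le> k" "0 < c j"
  shows "shift_down j c \<in> exponents k C"
  using sum_shift_down[where c = c and a = "\<lambda>_. 1", OF assms(2,3,4)] assms
  by (auto simp: exponents_def shift_down_def)

lemma shift_down_inj:
  assumes "shift_down j c = shift_down j d" "0 < c j" "0 < d j" "1 \<le> j"
  shows "c = d"
proof
  fix i
  have *: "shift_down j c i = shift_down j d i" using assms(1) by simp
  consider "i = j" | "i = j - 1" | "i \<noteq> j" "i \<noteq> j - 1" by blast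
  then show "c i = d i"
  proof cases
    case 1
    then have "j \<noteq> j - 1" using assms(4) by simp
    then show ?thesis using * 1 assms(2,3) by (simp add: shift_down_def del: One_nat_def)
  qed (use * in \<open>auto simp: shift_down_def\<close>)
qed

lemma shift_down_index_inj:
  assumes "shift_down i c = shift_down j c" "0 < c i" "0 < c j" "1 \<le> i" "1 \<le> j"
  shows "i = j"
proof (rule ccontr)
  assume "i \<noteq> j"
  have "shift_down i c j = shift_down j c j" using assms(1) by simp
  with \<open>i \<noteq> j\<close> assms(3,5) show False unfolding shift_down_def by (auto split: if_splits)
qed

definition weight :: "nat \<Rightarrow> (nat \<Rightarrow> nat) \<Rightarrow> nat" where
  "weight k c = (\<Sum>j\<le>k. j * c j)"

definition digits_value :: "nat \<Rightarrow> nat \<Rightarrow> (nat \<Rightarrow> nat) \<Rightarrow> nat" where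
  "digits_value b k c = (\<Sum>j\<le>k. b ^ j * c j)"

text \<open>Monomials are ordered by weight and, within a weight, lexicographically with the highest index first.
The order is encoded in one number, with the weight above the exponents as digits in base b.\<close>

definition monomial_rank :: "nat \<Rightarrow> nat \<Rightarrow> (nat \<Rightarrow> nat) \<Rightarrow> nat" where
  "monomial_rank b k c = weight k c * b ^ Suc k + digits_value b k c"

lemma digits_value_less:
  assumes "\<And>j. j \<le> k \<Longrightarrow> c j < b" shows "digits_value b k c < b ^ Suc k"
  using assms
proof (induction k)
  case (Suc k)
  have "digits_value b (Suc k) c = digits_value b k c + b ^ Suc k * c (Suc k)"
    by (simp add: digits_value_def)
  also have "\<dots> < b ^ Suc k * 1 + b ^ Suc k * c (Suc k)" using Suc by simp
  also have "\<dots> = b ^ Suc k * (Suc (c (Suc k)))" by simp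
  also have "\<dots> \<le> b ^ Suc k * b" using Suc.prems[of "Suc k"] by (intro mult_left_mono) auto
  finally show ?case by (simp add: mult_ac)
qed (simp add: digits_value_def)

lemma digits_value_inj:
  assumes "\<And>j. j \<le> k \<Longrightarrow> c j < b" "\<And>j. j \<le> k \<Longrightarrow> d j < b"
    "digits_value b k c = digits_value b k d" "j \<le> k"
  shows "c j = d j"
  using assms
proof (induction k arbitrary: j)
  case 0
  then show ?case by (simp add: digits_value_def)
next
  case (Suc k)
  have "digits_value b k c < b ^ Suc k" "digits_value b k d < b ^ Suc k"
    using Suc.prems by (auto intro!: digits_value_less simp del: power_Suc)
  moreover have eq: "digits_value b k c + b ^ Suc k * c (Suc k) = digits_value b k d + b ^ Suc k * d (Suc k)"
    using Suc.prems(3) by (simp add: digits_value_def)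
  moreover have "x < m \<Longrightarrow> (x + m * y) div m = y" for x y m :: nat by simp
  ultimately have "(digits_value b k c + b ^ Suc k * c (Suc k)) div b ^ Suc k = c (Suc k)"
    "(digits_value b k d + b ^ Suc k * d (Suc k)) div b ^ Suc k = d (Suc k)"
    by blast+
  with eq have top: "c (Suc k) = d (Suc k)" by simp
  with eq have "digits_value b k c = digits_value b k d" by simp
  then show ?case using Suc.IH[of j] Suc.prems top by (cases "j = Suc k") auto
qed

lemma monomial_rank_less_cases:
  assumes "c \<in> exponents k C" "d \<in> exponents k C" 
  shows "monomial_rank (C + 2) k c < monomial_rank (C + 2) k d \<longleftrightarrow>
    weight k c < weight k d \<or> weight k c = weight k d \<and> digits_value (C + 2) k c < digits_value (C + 2) k d"
proof -
  let ?b = "(C + 2) ^ Suc k"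
  have *: "digits_value (C + 2) k c < ?b" if "c \<in> exponents k C" for c
    using exponents_le[OF that] by (intro digits_value_less) (simp add: le_imp_less_Suc less_SucI)
  have lt: "weight k c * ?b + digits_value (C + 2) k c < weight k d * ?b + digits_value (C + 2) k d"
    if "weight k c < weight k d" "c \<in> exponents k C" for c d
  proof -
    have "weight k c * ?b + digits_value (C + 2) k c < (weight k c + 1) * ?b"
      using *[OF that(2)] by simp
    also have "\<dots> \<le> weight k d * ?b" using that(1) by (intro mult_right_mono) auto
    finally show ?thesis by simp
  qed
  show ?thesis
    using lt[of c d, OF _ assms(1)] lt[of d c, OF _ assms(2)]
    unfolding monomial_rank_def by (cases "weight k c" "weight k d" rule: linorder_cases) auto
qed

lemma inj_on_monomial_rank: "inj_on (monomial_rank (C + 2) k) (exponents k C)"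
proof (rule inj_onI)
  fix c d assume c: "c \<in> exponents k C" and d: "d \<in> exponents k C"
    and "monomial_rank (C + 2) k c = monomial_rank (C + 2) k d"
  then have "digits_value (C + 2) k c = digits_value (C + 2) k d"
    using monomial_rank_less_cases[OF c d] monomial_rank_less_cases[OF d c]
    by (metis less_irrefl nat_neq_iff)
  then have "c j = d j" if "j \<le> k" for j
    using digits_value_inj[of k c "C + 2" d j] exponents_le[OF c] exponents_le[OF d] that
    by (simp add: le_imp_less_Suc less_SucI)
  moreover have "c j = d j" if "j > k" for j using c d that by (simp add: exponents_def)
  ultimately show "c = d" by (metis ext linorder_not_le)
qed

lemma weight_shift_down:
  assumes "1 \<le> j" "j \<le> k" "0 < c j"
  shows "weight k c = weight k (shift_down j c) + 1"
  using sum_shift_down[where c = c and a = "\<lambda>i. i", OF assms] assms by (simp add: weight_def)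

lemma digits_value_shift_down:
  assumes "1 \<le> j" "j \<le> k" "0 < c j"
  shows "digits_value b k (shift_down j c) + b ^ j = digits_value b k c + b ^ (j - 1)"
  using sum_shift_down[where c = c and a = "\<lambda>i. b ^ i", OF assms] by (simp add: digits_value_def)

lemma polylog_matrix_nonzeroE:
  assumes "polylog_matrix z k c d \<noteq> 0"
  obtains j where "1 \<le> j" "j \<le> k" "0 < c j" "d = shift_down j c"
proof -
  have "\<exists>j\<in>{1..k}. 0 < c j \<and> d = shift_down j c"
  proof (rule ccontr)
    assume "\<not> (\<exists>j\<in>{1..k}. 0 < c j \<and> d = shift_down j c)"
    then have "polylog_matrix z k c d = 0" unfolding polylog_matrix_def
      by (intro sum.neutral ballI if_not_P) blast
    then show False using assms by simp
  qed
  then show ?thesis using that by auto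
qed

lemma degree_polylog_matrix_le:
  assumes "degree z \<le> 1" shows "degree (polylog_matrix z k c d) \<le> 1"
  unfolding polylog_matrix_def
  by (intro degree_sum_le) (use assms in \<open>auto intro: order_trans[OF degree_smult_le]\<close>)

section \<open>Horizontal vectors of the polylogarithm connection\<close>

lemma euler_factor_nonzero_mod: "prime p \<Longrightarrow> \<not> [:p:] dvd [:0, 1, -1 :: int:]"
  unfolding const_poly_dvd_iff not_all by (rule exI[of _ 1]) (simp add: not_prime_unit prime_int_iff)

definition bottom_exponent :: "nat \<Rightarrow> nat \<Rightarrow> nat" where
  "bottom_exponent C = (\<lambda>_. 0)(0 := C)"

lemma weight_eq_0_iff:
  assumes "c \<in> exponents k C"
  shows "weight k c = 0 \<longleftrightarrow> c = bottom_exponent C"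
proof
  assume "weight k c = 0"
  then have z: "c j = 0" if "j > 0" for j
  proof (cases "j \<le> k")
    case True
    then have "j * c j = 0" using \<open>weight k c = 0\<close> unfolding weight_def by simp
    then show ?thesis using that by simp
  next
    case False
    then show ?thesis using assms by (simp add: exponents_def)
  qed
  have "(\<Sum>j\<le>k. c j) = c 0 + (\<Sum>j=1..k. c j)"
    by (metis One_nat_def atLeast0AtMost sum.atLeast_Suc_atMost zero_le)
  also have "\<dots> = c 0" using z by simp
  finally have "c 0 = C" using assms by (simp add: exponents_def)
  with z show "c = bottom_exponent C" by (auto simp: bottom_exponent_def)
next
  assume "c = bottom_exponent C"
  then show "weight k c = 0" by (simp add: bottom_exponent_def weight_def)
qed

text \<open>The coefficients of z and of 1 - x in the matrix of E are kept apart, because they govern the residues at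
1 and at 0 respectively.\<close>

definition first_matrix :: "nat \<Rightarrow> (nat \<Rightarrow> nat) \<Rightarrow> (nat \<Rightarrow> nat) \<Rightarrow> int" where
  "first_matrix k c d = (if 1 \<le> k \<and> 0 < c 1 \<and> d = shift_down 1 c then int (c 1) else 0)"

definition higher_matrix :: "nat \<Rightarrow> (nat \<Rightarrow> nat) \<Rightarrow> (nat \<Rightarrow> nat) \<Rightarrow> int" where
  "higher_matrix k c d = (\<Sum>j=2..k. if 0 < c j \<and> d = shift_down j c then int (c j) else 0)"

lemma higher_matrix_nonzeroE:
  assumes "higher_matrix k c d \<noteq> 0"
  obtains j where "j \<in> {2..k}" "0 < c j" "d = shift_down j c"
proof -
  have "\<exists>j\<in>{2..k}. 0 < c j \<and> d = shift_down j c"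
  proof (rule ccontr)
    assume "\<not> (\<exists>j\<in>{2..k}. 0 < c j \<and> d = shift_down j c)"
    then have "higher_matrix k c d = 0" unfolding higher_matrix_def
      by (intro sum.neutral ballI if_not_P) blast
    then show False using assms by simp
  qed
  then show ?thesis using that by auto
qed

lemma polylog_matrix_split:
  "polylog_matrix z k c d = smult (first_matrix k c d) z + smult (higher_matrix k c d) [:1, -1:]"
proof (cases "1 \<le> k")
  case True
  have "{1..k} = insert 1 {2..k}" using True by auto
  then have "polylog_matrix z k c d = smult (first_matrix k c d) z
     + (\<Sum>j=2..k. if 0 < c j \<and> d = shift_down j c then smult (int (c j)) [:1, -1:] else 0)"
    using True by (auto simp: polylog_matrix_def first_matrix_def intro!: sum.cong)
  also have "(\<Sum>j=2..k. if 0 < c j \<and> d = shift_down j c then smult (int (c j)) [:1, -1:] else 0)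
    = smult (higher_matrix k c d) [:1, -1:]"
    unfolding higher_matrix_def smult_sum by (intro sum.cong) auto
  finally show ?thesis .
next
  case False
  then show ?thesis by (simp add: polylog_matrix_def first_matrix_def higher_matrix_def)
qed

lemma monomial_rank_polylog_matrix_less:
  assumes "c \<in> exponents k C" "d \<in> exponents k C" "polylog_matrix z k c d \<noteq> 0"
  shows "monomial_rank (C + 2) k d < monomial_rank (C + 2) k c"
  using assms(3)
proof (rule polylog_matrix_nonzeroE)
  fix j assume "1 \<le> j" "j \<le> k" "0 < c j" "d = shift_down j c"
  then show ?thesis
    using weight_shift_down[of j k c] monomial_rank_less_cases[OF assms(2,1)] by simp
qed

text \<open>Divide w by w_t. The entries of the same weight as t satisfy homogeneous equations, so they are scalars,
because degrees are less than p. Let t have a positive exponent at an index j >= 1, with j minimal, and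
let d be t shifted down at j. The equation at d expresses the derivative of w_d / w_t as
alpha / (1 - x) + beta / x with scalars alpha and beta, up to sign; so both vanish. But alpha is t_j if
j = 1. If j > 1, then beta is t_j plus contributions of vectors that shift down to d at an index i
other than j: if i < j, then d would have a positive exponent at i - 1, which contradicts the choice of
j; if i > j, then the vector ranks above t and its scalar is zero.\<close>

lemma top_of_horizontal_is_bottom:
  fixes w :: "(nat \<Rightarrow> nat) \<Rightarrow> int poly"
  defines "K \<equiv> polylog_matrix [:0, 1:]" and "\<rho> \<equiv> \<lambda>k C. monomial_rank (C + 2) k"
  assumes p: "prime p" and C: "int C < p" and t: "t \<in> exponents k C" "\<not> [:p:] dvd w t"
    and top: "\<And>c. c \<in> exponents k C \<Longrightarrow> \<rho> k C t < \<rho> k C c \<Longrightarrow> [:p:] dvd w c"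
    and deg: "\<And>c. c \<in> exponents k C \<Longrightarrow> int (degree (w c)) < p"
    and hor: "\<And>d. d \<in> exponents k C \<Longrightarrow>
       [:p:] dvd w t * connection (exponents k C) (K k) w d - euler (w t) * w d"
  shows "t = bottom_exponent C"
proof (rule ccontr)
  let ?I = "exponents k C"
  assume "t \<noteq> bottom_exponent C"
  then have "weight k t \<noteq> 0" using weight_eq_0_iff[OF t(1)] by simp
  then have "\<exists>j. 1 \<le> j \<and> j \<le> k \<and> 0 < t j" unfolding weight_def
    by (metis (no_types, lifting) One_nat_def Suc_leI atMost_iff bot_nat_0.not_eq_extremum mult_is_0 sum.neutral)
  then obtain j where j: "1 \<le> j" "j \<le> k" "0 < t j"
    and jmin: "\<And>i. 1 \<le> i \<Longrightarrow> i < j \<Longrightarrow> t i = 0"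
    using exists_least_iff[of "\<lambda>j. 1 \<le> j \<and> j \<le> k \<and> 0 < t j"] by force
  define d where "d = shift_down j t"
  have d: "d \<in> ?I" unfolding d_def using shift_down_in_exponents t(1) j by blast
  have wd: "weight k t = weight k d + 1" unfolding d_def using weight_shift_down j by blast
  have higher: "[:p:] dvd w c" if "c \<in> ?I" "weight k t < weight k c" for c
    using top[OF that(1)] monomial_rank_less_cases[OF t(1) that(1)] that(2) by (simp add: \<rho>_def)
  have wK: "weight k c = weight k d + 1" if "K k c d \<noteq> 0" for c d
    using that weight_shift_down unfolding K_def by (metis polylog_matrix_nonzeroE)
  have "\<exists>a. [:p:] dvd w c - smult a (w t)" if c: "c \<in> ?I" "weight k c = weight k t" for c
  proof -
    have "[:p:] dvd (\<Sum>c'\<in>?I. w c' * K k c' c)"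
    proof (rule dvd_sum)
      fix c' assume c': "c' \<in> ?I"
      show "[:p:] dvd w c' * K k c' c"
      proof (cases "K k c' c = 0")
        case False
        then show ?thesis using higher[OF c'] wK[OF False] c(2) by simp
      qed simp
    qed
    then have "[:p:] dvd w t * (\<Sum>c'\<in>?I. w c' * K k c' c)" by (rule dvd_mult)
    with hor[OF c(1)] have "[:p:] dvd w t * connection ?I (K k) w c - euler (w t) * w c
       - w t * (\<Sum>c'\<in>?I. w c' * K k c' c)" by (rule dvd_diff)
    also have "\<dots> = [:0, 1, -1:] * wronskian (w c) (w t)"
      by (simp add: connection_def euler_def wronskian_def algebra_simps)
    finally have "[:p:] dvd wronskian (w c) (w t)"
      using euler_factor_nonzero_mod[OF p] prime_const_poly_dvd_mult_iff[OF p] by blast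
    then show ?thesis
      using wronskian_zero_imp_proportional[OF p deg[OF c(1)] deg[OF t(1)] t(2)] by blast
  qed
  then obtain a where a: "\<And>c. c \<in> ?I \<Longrightarrow> weight k c = weight k t \<Longrightarrow> [:p:] dvd w c - smult (a c) (w t)"
    by metis
  have at: "\<not> p dvd a t"
  proof
    assume "p dvd a t"
    then have "[:p:] dvd smult (a t) (w t)" by (auto simp: const_poly_dvd_iff)
    then show False using a[OF t(1)] t(2) by (metis dvd_diff_left_iff)
  qed
  have a0: "p dvd a c" if "c \<in> ?I" "weight k c = weight k t" "\<rho> k C t < \<rho> k C c" for c
  proof -
    have "[:p:] dvd smult (a c) (w t)" using a[OF that(1,2)] top[OF that(1,3)] by (metis dvd_diff_right_iff)
    then have "[:p:] dvd [:a c:] * w t" by simp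
    then have "[:p:] dvd [:a c:]" using prime_const_poly_dvd_mult_iff[OF p] t(2) by blast
    then show ?thesis by simp
  qed
  \<comment> \<open>The residues at 1 and at 0 of the derivative of w d / w t, up to sign.\<close>
  define \<alpha> where "\<alpha> = (\<Sum>c\<in>?I. a c * first_matrix k c d)"
  define \<beta> where "\<beta> = (\<Sum>c\<in>?I. a c * higher_matrix k c d)"
  have "[:p:] dvd (\<Sum>c\<in>?I. w c * K k c d) - (\<Sum>c\<in>?I. smult (a c) (w t) * K k c d)"
    unfolding sum_subtractf[symmetric]
  proof (rule dvd_sum)
    fix c assume c: "c \<in> ?I"
    show "[:p:] dvd w c * K k c d - smult (a c) (w t) * K k c d"
    proof (cases "K k c d = 0")
      case False
      then have "[:p:] dvd (w c - smult (a c) (w t)) * K k c d" using a[OF c] wK[OF False] wd by simp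
      then show ?thesis by (simp add: left_diff_distrib)
    qed simp
  qed
  moreover have "(\<Sum>c\<in>?I. smult (a c) (w t) * K k c d) = w t * (smult \<alpha> [:0, 1:] + smult \<beta> [:1, -1:])"
    unfolding K_def polylog_matrix_split \<alpha>_def \<beta>_def
    by (simp only: smult_sum sum_distrib_left distrib_left sum.distrib mult_smult_left mult_smult_right smult_smult mult.commute[where 'a = int])
  ultimately have "[:p:] dvd w t * ((\<Sum>c\<in>?I. w c * K k c d) - w t * (smult \<alpha> [:0, 1:] + smult \<beta> [:1, -1:]))"
    by simp
  with hor[OF d] have "[:p:] dvd (w t * connection ?I (K k) w d - euler (w t) * w d)
     - w t * ((\<Sum>c\<in>?I. w c * K k c d) - w t * (smult \<alpha> [:0, 1:] + smult \<beta> [:1, -1:]))"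
    by (rule dvd_diff)
  also have "(w t * connection ?I (K k) w d - euler (w t) * w d)
     - w t * ((\<Sum>c\<in>?I. w c * K k c d) - w t * (smult \<alpha> [:0, 1:] + smult \<beta> [:1, -1:]))
    = [:0, 1, -1:] * wronskian (w d) (w t) - w t * w t * (smult (-\<alpha>) [:0, 1:] + smult (-\<beta>) [:1, -1:])"
  proof -
    have "smult (-\<alpha>) [:0, 1:] + smult (-\<beta>) [:1, -1:] = - (smult \<alpha> [:0, 1:] + smult \<beta> [:1, -1:])"
      by simp
    moreover have "(a * (X * b' + S) - X * a' * b) - a * (S - a * P) = X * (b' * a - b * a') - a * a * - P"
      for a b a' b' X S P :: "int poly"
      by (simp add: algebra_simps)
    ultimately show ?thesis unfolding connection_def euler_def wronskian_def by presburger
  qed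
  finally have res: "[:p:] dvd [:0, 1, -1:] * wronskian (w d) (w t)
    - w t * w t * (smult (-\<alpha>) [:0, 1:] + smult (-\<beta>) [:1, -1:])" .
  have alpha: "p dvd \<alpha>" using residue_at_1[OF p deg[OF d] deg[OF t(1)] t(2) res] by simp
  have beta: "p dvd \<beta>" using residue_at_0[OF p deg[OF d] deg[OF t(1)] t(2) res] by simp
  have tj: "\<not> p dvd int (t j)"
    using j(3) exponents_le[OF t(1), of j] C by (auto dest: zdvd_imp_le)
  have fin: "finite ?I" by (rule finite_exponents)
  show False
  proof (cases "j = 1")
    case True
    have "first_matrix k c d = 0" if "c \<noteq> t" for c
      using that shift_down_inj[of 1 t c] j True unfolding first_matrix_def d_def by auto
    then have "\<alpha> = a t * first_matrix k t d"
      unfolding \<alpha>_def using fin t(1) by (simp add: sum.remove[of _ t])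
    also have "\<dots> = a t * int (t j)" using j True by (simp add: first_matrix_def d_def)
    finally show False using alpha at tj p by (simp add: prime_dvd_mult_iff)
  next
    case False
    have "p dvd a c * higher_matrix k c d" if c: "c \<in> ?I - {t}" for c
    proof (cases "higher_matrix k c d = 0")
      case False
      then obtain i where i: "i \<in> {2..k}" "0 < c i" "d = shift_down i c"
        by (rule higher_matrix_nonzeroE)
      have "i \<noteq> j"
      proof
        assume "i = j"
        then have "c = t" using shift_down_inj[of j c t] i j by (simp add: d_def)
        then show False using c by simp
      qed
      moreover have "\<not> i < j"
      proof
        assume "i < j"
        have "d (i - 1) = c (i - 1) + 1" using i by (simp add: shift_down_def)
        moreover have "d (i - 1) = t (i - 1)" using \<open>i < j\<close> i(1) by (auto simp: d_def shift_down_def)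
        moreover have "t (i - 1) = 0" using jmin[of "i - 1"] \<open>i < j\<close> i(1) by auto
        ultimately show False by simp
      qed
      ultimately have ij: "j < i" by simp
      have wc: "weight k c = weight k t" using weight_shift_down[of i k c] i wd by simp
      let ?b = "C + 2"
      have e1: "digits_value ?b k d + ?b ^ i = digits_value ?b k c + ?b ^ (i - 1)"
        using digits_value_shift_down[of i k c] i by simp
      have e2: "digits_value ?b k d + ?b ^ j = digits_value ?b k t + ?b ^ (j - 1)"
        using digits_value_shift_down[of j k t] j by (simp add: d_def)
      have "?b ^ j \<le> ?b ^ (i - 1)" using ij by (intro power_increasing) auto
      moreover have "?b ^ i = ?b * ?b ^ (i - 1)" using i(1) by (cases i) auto
      then have "?b ^ i \<ge> 2 * ?b ^ (i - 1)" by simp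
      moreover have "?b ^ (j - 1) > 0" by simp
      ultimately have "digits_value ?b k t < digits_value ?b k c" using e1 e2 by linarith
      then have "\<rho> k C t < \<rho> k C c"
        using monomial_rank_less_cases[OF t(1), of c] c wc by (simp add: \<rho>_def)
      then show ?thesis using a0[of c] c wc by simp
    qed simp
    then have "p dvd (\<Sum>c\<in>?I - {t}. a c * higher_matrix k c d)" by (rule dvd_sum)
    moreover have "\<beta> = a t * higher_matrix k t d + (\<Sum>c\<in>?I - {t}. a c * higher_matrix k c d)"
      unfolding \<beta>_def using fin t(1) by (rule sum.remove)
    ultimately have "p dvd a t * higher_matrix k t d" using beta by (simp add: dvd_add_left_iff)
    moreover have "higher_matrix k t d = int (t j)"
    proof -
      have "(if 0 < t i \<and> d = shift_down i t then int (t i) else 0) = (if i = j then int (t j) else 0)"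
        if "i \<in> {2..k}" for i
        using shift_down_index_inj[of i t j] that j unfolding d_def by auto
      then have "higher_matrix k t d = (\<Sum>i=2..k. if i = j then int (t j) else 0)"
        unfolding higher_matrix_def by (intro sum.cong) auto
      then show ?thesis using j False by simp
    qed
    ultimately show False using at tj p by (simp add: prime_dvd_mult_iff)
  qed
qed

section \<open>Truncated polylogarithms modulo p\<close>

text \<open>By Fermat's theorem, i^(p-2) is the inverse of i modulo p, so this is an integer lift of the truncated
polylogarithm of order j.\<close>

definition polylog :: "nat \<Rightarrow> nat \<Rightarrow> int poly" where
  "polylog p j = (\<Sum>i=1..p-1. monom ((int i ^ (p - 2)) ^ j) i)"

lemma coeff_polylog: "coeff (polylog p j) i = (if i \<in> {1..p-1} then (int i ^ (p - 2)) ^ j else 0)"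
  by (simp add: polylog_def coeff_sum sum.delta')

lemma degree_polylog_le: "degree (polylog p j) \<le> p - 1"
  by (rule degree_le) (auto simp: coeff_polylog)

lemma modular_inverse_power:
  assumes "prime p" "i \<in> {1..p - 1}"
  shows "int p dvd int i * int i ^ (p - 2) - 1"
proof -
  have "p \<ge> 2" using assms(1) prime_ge_2_nat by blast
  have "\<not> p dvd i" using assms by (auto dest: dvd_imp_le)
  then have "[i ^ (p - 1) = 1] (mod p)" using assms(1) fermat_theorem by blast
  moreover have "p - 1 = Suc (p - 2)" using \<open>p \<ge> 2\<close> by simp
  ultimately have "[int (i * i ^ (p - 2)) = int 1] (mod int p)" unfolding cong_int_iff by simp
  then show ?thesis by (simp add: cong_iff_dvd_diff)
qed

lemma euler_factor: "euler f = [:1, -1:] * ([:0, 1:] * pderiv f)"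
  unfolding euler_def mult.assoc[symmetric] by (rule arg_cong2[where f = "(*)"]) simp_all

lemma euler_polylog_Suc:
  assumes "prime p"
  shows "[:int p:] dvd euler (polylog p (Suc j)) - [:1, -1:] * polylog p j"
proof -
  have "[:int p:] dvd [:0, 1:] * pderiv (polylog p (Suc j)) - polylog p j"
    unfolding const_poly_dvd_iff
  proof
    fix i
    show "int p dvd coeff ([:0, 1:] * pderiv (polylog p (Suc j)) - polylog p j) i"
    proof (cases "i \<in> {1..p-1}")
      case True
      then have "coeff ([:0, 1:] * pderiv (polylog p (Suc j)) - polylog p j) i
         = (int i * int i ^ (p - 2) - 1) * (int i ^ (p - 2)) ^ j"
        unfolding coeff_diff coeff_theta coeff_polylog by (simp add: algebra_simps)
      then show ?thesis using modular_inverse_power[OF assms True] by simp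
    next
      case False
      then have "coeff ([:0, 1:] * pderiv (polylog p (Suc j)) - polylog p j) i = 0"
        unfolding coeff_diff coeff_theta coeff_polylog by (simp only: if_False mult_zero_right diff_0_right)
      then show ?thesis by (simp only: dvd_0_right)
    qed
  qed
  then have "[:int p:] dvd [:1, -1:] * ([:0, 1:] * pderiv (polylog p (Suc j)) - polylog p j)"
    by (rule dvd_mult)
  then show ?thesis unfolding euler_factor by (simp only: right_diff_distrib)
qed

lemma polylog_0:
  assumes "p \<ge> 1" shows "[:1, -1:] * polylog p 0 = [:0, 1:] - monom 1 p"
proof (rule poly_eqI)
  fix i
  have "coeff ([:1, -1:] * polylog p 0) i = coeff (polylog p 0) i - (case i of 0 \<Rightarrow> 0 | Suc m \<Rightarrow> coeff (polylog p 0) m)"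
    by (cases i) (simp_all add: coeff_pCons)
  then show "coeff ([:1, -1:] * polylog p 0) i = coeff ([:0, 1:] - monom 1 p) i"
    using assms by (cases i) (auto simp: coeff_polylog coeff_pCons split: nat.splits)
qed

definition polylog_factor :: "nat \<Rightarrow> nat \<Rightarrow> int poly" where
  "polylog_factor p j = (if j = 0 then 1 else polylog p j)"

definition polylog_monomial :: "nat \<Rightarrow> nat \<Rightarrow> (nat \<Rightarrow> nat) \<Rightarrow> int poly" where
  "polylog_monomial p k c = (\<Prod>j\<le>k. polylog_factor p j ^ c j)"

definition artin_schreier :: "nat \<Rightarrow> int poly" where
  "artin_schreier p = [:0, 1:] - monom 1 p"

lemma euler_polylog_factor:
  assumes "prime p" "j \<ge> 1"
  shows "[:int p:] dvd euler (polylog_factor p j)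
    - (if j = 1 then artin_schreier p else [:1, -1:]) * polylog_factor p (j - 1)"
proof -
  obtain i where i: "j = Suc i" using assms(2) by (cases j) auto
  have "p \<ge> 1" using assms(1) prime_ge_1_nat by blast
  show ?thesis
  proof (cases "i = 0")
    case True
    then show ?thesis using euler_polylog_Suc[OF assms(1), of i] polylog_0[OF \<open>p \<ge> 1\<close>]
      by (simp add: i polylog_factor_def artin_schreier_def)
  next
    case False
    then show ?thesis using euler_polylog_Suc[OF assms(1), of i] by (simp add: i polylog_factor_def)
  qed
qed

lemma euler_power: "euler (f ^ n) = smult (int n) (f ^ (n - 1)) * euler f"
  by (simp add: euler_def pderiv_power algebra_simps)

lemma euler_prod: "euler (prod f A) = (\<Sum>a\<in>A. prod f (A - {a}) * euler (f a))"
  by (simp add: euler_def pderiv_prod sum_distrib_left algebra_simps)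

lemma polylog_monomial_shift_down:
  assumes "1 \<le> j" "j \<le> k" "0 < c j"
  shows "polylog_monomial p k (shift_down j c) =
    prod (\<lambda>i. polylog_factor p i ^ c i) ({..k} - {j}) * polylog_factor p j ^ (c j - 1) * polylog_factor p (j - 1)"
proof -
  let ?f = "polylog_factor p" and ?R = "{..k} - {j} - {j - 1}"
  have ne: "j \<noteq> j - 1" using assms by simp
  have split: "prod g {..k} = g j * (g (j - 1) * prod g ?R)" "prod g ({..k} - {j}) = g (j - 1) * prod g ?R"
    for g :: "nat \<Rightarrow> int poly"
    using assms ne by (simp_all add: prod.remove[of "{..k}" j] prod.remove[of "{..k} - {j}" "j - 1"])
  have R: "prod (\<lambda>i. ?f i ^ shift_down j c i) ?R = prod (\<lambda>i. ?f i ^ c i) ?R"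
    by (intro prod.cong) (auto simp: shift_down_def)
  have s: "shift_down j c j = c j - 1" "shift_down j c (j - 1) = c (j - 1) + 1"
    using ne by (auto simp: shift_down_def)
  show ?thesis
    unfolding polylog_monomial_def split R s by (simp add: mult_ac)
qed

lemma euler_polylog_monomial:
  assumes p: "prime p" and c: "c \<in> exponents k C"
  shows "[:int p:] dvd (\<Sum>d\<in>exponents k C. polylog_matrix (artin_schreier p) k c d * polylog_monomial p k d)
    - euler (polylog_monomial p k c)"
proof -
  let ?g = "\<lambda>j. if j = 1 then artin_schreier p else [:1, -1:]" and ?f = "polylog_factor p"
  let ?R = "\<lambda>j. prod (\<lambda>i. ?f i ^ c i) ({..k} - {j}) * ?f j ^ (c j - 1)"
  have "(\<Sum>d\<in>exponents k C. polylog_matrix (artin_schreier p) k c d * polylog_monomial p k d)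
    = (\<Sum>j=1..k. \<Sum>d\<in>exponents k C. (if d = shift_down j c then
         (if 0 < c j then smult (int (c j)) (?g j) * polylog_monomial p k d else 0) else 0))"
    unfolding polylog_matrix_def sum_distrib_right
    by (subst sum.swap) (intro sum.cong refl; auto)
  also have "\<dots> = (\<Sum>j=1..k. if 0 < c j then smult (int (c j)) (?g j) * polylog_monomial p k (shift_down j c) else 0)"
    using finite_exponents shift_down_in_exponents[OF c] by (intro sum.cong refl) (auto simp: sum.delta)
  also have "\<dots> = (\<Sum>j=1..k. ?R j * smult (int (c j)) (?g j * ?f (j - 1)))"
    using polylog_monomial_shift_down[of _ k c p] by (intro sum.cong refl) (auto simp: mult_ac)
  finally have 1: "(\<Sum>d\<in>exponents k C. polylog_matrix (artin_schreier p) k c d * polylog_monomial p k d)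
    = (\<Sum>j=1..k. ?R j * smult (int (c j)) (?g j * ?f (j - 1)))" .
  have "{..k} = insert 0 {1..k}" by auto
  moreover have "euler (?f 0 ^ c 0) = 0" by (simp add: polylog_factor_def euler_def)
  ultimately have "euler (polylog_monomial p k c) = (\<Sum>j=1..k. prod (\<lambda>i. ?f i ^ c i) ({..k} - {j}) * euler (?f j ^ c j))"
    unfolding polylog_monomial_def euler_prod by simp
  also have "\<dots> = (\<Sum>j=1..k. ?R j * smult (int (c j)) (euler (?f j)))"
    by (simp add: euler_power mult_ac)
  finally have 2: "euler (polylog_monomial p k c) = \<dots>" .
  show ?thesis unfolding 1 2 sum_subtractf[symmetric]
  proof (rule dvd_sum)
    fix j assume "j \<in> {1..k}"
    then have "[:int p:] dvd euler (?f j) - ?g j * ?f (j - 1)"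
      using euler_polylog_factor[OF p, of j] by simp
    then have "[:int p:] dvd - (?R j * [:int (c j):] * (euler (?f j) - ?g j * ?f (j - 1)))"
      by (simp only: dvd_minus_iff dvd_mult)
    then show "[:int p:] dvd ?R j * smult (int (c j)) (?g j * ?f (j - 1)) - ?R j * smult (int (c j)) (euler (?f j))"
      by (simp add: smult_diff_right right_diff_distrib mult.assoc)
  qed
qed

definition evaluate :: "nat \<Rightarrow> nat \<Rightarrow> nat \<Rightarrow> ((nat \<Rightarrow> nat) \<Rightarrow> int poly) \<Rightarrow> int poly" where
  "evaluate p k C w = (\<Sum>c\<in>exponents k C. w c * polylog_monomial p k c)"

lemma evaluate_connection:
  "evaluate p k C (connection (exponents k C) K w) = euler (evaluate p k C w)
    + (\<Sum>c\<in>exponents k C. w c * ((\<Sum>d\<in>exponents k C. K c d * polylog_monomial p k d) - euler (polylog_monomial p k c)))"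
proof -
  let ?I = "exponents k C"
  have "(\<Sum>d\<in>?I. (\<Sum>c\<in>?I. w c * K c d) * polylog_monomial p k d)
    = (\<Sum>c\<in>?I. w c * (\<Sum>d\<in>?I. K c d * polylog_monomial p k d))"
    unfolding sum_distrib_left sum_distrib_right by (subst sum.swap) (simp add: mult_ac)
  then show ?thesis
    by (simp add: evaluate_def connection_def distrib_right sum.distrib euler_sum euler_mult
        right_diff_distrib sum_subtractf)
qed

lemma evaluate_connection_mod:
  assumes "prime p"
  shows "[:int p:] dvd evaluate p k C (connection (exponents k C) (polylog_matrix (artin_schreier p) k) w)
    - euler (evaluate p k C w)"
  unfolding evaluate_connection using euler_polylog_monomial[OF assms] by (simp add: dvd_sum)

section \<open>The zero estimate\<close>

text \<open>Membership in the ideal generated by p and x^p.\<close>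

definition low_order_zero :: "nat \<Rightarrow> int poly \<Rightarrow> bool" where
  "low_order_zero p f \<longleftrightarrow> (\<forall>i<p. int p dvd coeff f i)"

lemma low_order_zero_add: "low_order_zero p f \<Longrightarrow> low_order_zero p g \<Longrightarrow> low_order_zero p (f + g)"
  by (simp add: low_order_zero_def)

lemma low_order_zero_mult: "low_order_zero p f \<Longrightarrow> low_order_zero p (g * f)"
  unfolding low_order_zero_def coeff_mult by (auto intro!: dvd_sum dvd_mult)

lemma low_order_zero_sum: "(\<And>x. x \<in> A \<Longrightarrow> low_order_zero p (f x)) \<Longrightarrow> low_order_zero p (sum f A)"
  unfolding low_order_zero_def coeff_sum by (auto intro!: dvd_sum)

lemma low_order_zero_dvd: "[:int p:] dvd f \<Longrightarrow> low_order_zero p f"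
  by (simp add: low_order_zero_def const_poly_dvd_iff)

lemma low_order_zero_monom: "low_order_zero p (monom a p)"
  by (simp add: low_order_zero_def)

lemma low_order_zero_euler: "low_order_zero p f \<Longrightarrow> low_order_zero p (euler f)"
  unfolding euler_factor by (rule low_order_zero_mult) (simp only: low_order_zero_def coeff_theta, simp)

text \<open>Replacing x - x^p by x in the matrix changes it by multiples of x^p.\<close>

lemma low_order_zero_connection:
  assumes p: "prime p" and w: "low_order_zero p (evaluate p k C w)"
  shows "low_order_zero p (evaluate p k C (connection (exponents k C) (polylog_matrix [:0, 1:] k) w))"
proof -
  let ?I = "exponents k C" and ?K = "\<lambda>z. polylog_matrix z k" and ?f = "polylog_monomial p k"
  have "low_order_zero p (w c * ((\<Sum>d\<in>?I. ?K [:0, 1:] c d * ?f d) - euler (?f c)))" if c: "c \<in> ?I" for c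
  proof (rule low_order_zero_mult)
    have "?K [:0, 1:] c d = ?K (artin_schreier p) c d + [:first_matrix k c d:] * monom 1 p" for d
      unfolding polylog_matrix_split artin_schreier_def by (simp add: smult_diff_right)
    then have eq: "(\<Sum>d\<in>?I. ?K [:0, 1:] c d * ?f d) - euler (?f c)
      = ((\<Sum>d\<in>?I. ?K (artin_schreier p) c d * ?f d) - euler (?f c)) + (\<Sum>d\<in>?I. [:first_matrix k c d:] * ?f d) * monom 1 p"
      by (simp add: distrib_left sum.distrib sum_distrib_left mult_ac)
    show "low_order_zero p ((\<Sum>d\<in>?I. ?K [:0, 1:] c d * ?f d) - euler (?f c))"
      unfolding eq
      by (intro low_order_zero_add low_order_zero_dvd low_order_zero_mult low_order_zero_monom
          euler_polylog_monomial p c)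
  qed
  then show ?thesis unfolding evaluate_connection
    by (intro low_order_zero_add low_order_zero_euler w low_order_zero_sum)
qed

text \<open>The combination belonging to the horizontal vector w is congruent to its coefficient at the constant
monomial, a polynomial of degree less than p. It is zero modulo p and x^p, hence modulo p.\<close>

lemma zero_estimate:
  fixes v :: "(nat \<Rightarrow> nat) \<Rightarrow> int poly"
  defines "n \<equiv> \<lambda>k C. card (exponents k C)"
  assumes p: "prime p" and C: "C < p" and small: "(n k C + 1) * (A + n k C) < p"
    and deg: "\<And>c. c \<in> exponents k C \<Longrightarrow> degree (v c) \<le> A"
    and nz: "\<exists>c\<in>exponents k C. \<not> [:int p:] dvd v c"
  shows "\<not> low_order_zero p (evaluate p k C v)"
proof
  assume low: "low_order_zero p (evaluate p k C v)"
  let ?I = "exponents k C" and ?K = "polylog_matrix [:0, 1:] k" and ?\<rho> = "monomial_rank (C + 2) k"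
  have pp: "prime (int p)" using p by simp
  have degK: "degree (?K c d) \<le> 1" for c d by (rule degree_polylog_matrix_le) simp
  obtain q w t where w: "w = (\<lambda>c. \<Sum>i<card ?I. q i * (connection ?I ?K ^^ i) v c)" "t \<in> ?I" "\<not> [:int p:] dvd w t"
    and top: "\<And>c. c \<in> ?I \<Longrightarrow> ?\<rho> t < ?\<rho> c \<Longrightarrow> [:int p:] dvd w c"
    and wdeg: "\<And>c. c \<in> ?I \<Longrightarrow> degree (w c) \<le> (card ?I + 1) * (A + card ?I)"
    and hor: "\<And>d. d \<in> ?I \<Longrightarrow> [:int p:] dvd w t * connection ?I ?K w d - euler (w t) * w d"
    by (rule exists_horizontal_up_to_scaling[where p = "int p" and I = ?I and K = ?K and \<rho> = ?\<rho> and v = v and A = A,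
          OF pp finite_exponents inj_on_monomial_rank degK monomial_rank_polylog_matrix_less deg nz];
        (assumption | (rule that; (assumption | blast))))
  have wdeg': "degree (w c) < p" if "c \<in> ?I" for c
    using wdeg[OF that] small by (simp add: n_def)
  have t: "t = bottom_exponent C"
    by (rule top_of_horizontal_is_bottom[where w = w and t = t, OF pp _ w(2,3)]) (use C top wdeg' hor in auto)
  have other: "[:int p:] dvd w c" if "c \<in> ?I" "c \<noteq> t" for c
  proof (rule top[OF that(1)])
    have "weight k t = 0" "weight k c \<noteq> 0" using weight_eq_0_iff that w(2) t by auto
    then show "?\<rho> t < ?\<rho> c" using monomial_rank_less_cases[OF w(2) that(1)] by simp
  qed
  have "low_order_zero p (evaluate p k C ((connection ?I ?K ^^ i) v))" for i
    by (induction i) (auto intro: low low_order_zero_connection[OF p])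
  then have "low_order_zero p (\<Sum>i<card ?I. q i * evaluate p k C ((connection ?I ?K ^^ i) v))"
    by (intro low_order_zero_sum low_order_zero_mult)
  also have "(\<Sum>i<card ?I. q i * evaluate p k C ((connection ?I ?K ^^ i) v)) = evaluate p k C w"
    unfolding evaluate_def w(1) sum_distrib_left sum_distrib_right
    by (subst sum.swap) (simp add: mult_ac)
  finally have "low_order_zero p (evaluate p k C w)" .
  moreover have "polylog_monomial p k t = 1"
    unfolding polylog_monomial_def t by (rule prod.neutral) (auto simp: bottom_exponent_def polylog_factor_def)
  then have "w t = evaluate p k C w + - (\<Sum>c\<in>?I - {t}. w c * polylog_monomial p k c)"
    using w(2) finite_exponents by (simp add: evaluate_def sum.remove[of _ t])
  moreover have "[:int p:] dvd - (\<Sum>c\<in>?I - {t}. w c * polylog_monomial p k c)"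
    unfolding dvd_minus_iff using other by (auto intro!: dvd_sum dvd_mult2)
  ultimately have "low_order_zero p (w t)" by (simp only: low_order_zero_add low_order_zero_dvd)
  then have "[:int p:] dvd w t"
    unfolding const_poly_dvd_iff low_order_zero_def using wdeg'[OF w(2)]
    by (metis coeff_eq_0 dvd_0_right linorder_not_less order_less_le_trans)
  then show False using w(3) by simp
qed

section \<open>Counting multiple roots modulo p\<close>

lemma const_poly_dvd_imp_dvd_poly: "[:p:] dvd f \<Longrightarrow> (p::int) dvd poly f s"
  by (elim dvdE) auto

lemma linear_factor_nonzero_mod: "prime p \<Longrightarrow> \<not> [:p:] dvd [:- s, 1 :: int:]"
  unfolding const_poly_dvd_iff not_all by (rule exI[of _ 1]) (simp add: not_prime_unit prime_int_iff)

lemma linear_factor_mod: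
  assumes "(p::int) dvd poly G s"
  obtains H where "[:p:] dvd G - [:- s, 1:] * H"
proof -
  have "G - [:- s, 1:] * synthetic_div G s = [:poly G s:]"
    using synthetic_div_correct'[of s G] by (simp add: algebra_simps)
  then show ?thesis using assms that[of "synthetic_div G s"] by simp
qed

lemma const_poly_dvd_euler_funpow_diff:
  assumes "[:p:] dvd f - g" shows "[:p:] dvd (euler ^^ m) f - (euler ^^ m) g"
proof (induction m)
  case (Suc m)
  then show ?case using const_poly_dvd_euler euler_diff by (metis comp_apply funpow.simps(2))
qed (use assms in simp)

text \<open>Since x (1 - x) does not vanish at s, each application of E lowers the exact order of vanishing at s by
one, as long as the order is less than p.\<close>

lemma euler_funpow_at_exact_order:
  fixes G :: "int poly"
  assumes p: "prime p" and s: "\<not> p dvd s * (1 - s)" and e: "int e < p" and G: "\<not> p dvd poly G s"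
  shows "\<not> p dvd poly ((euler ^^ e) ([:- s, 1:] ^ e * G)) s"
  using e G
proof (induction e arbitrary: G)
  case (Suc e)
  let ?X = "[:- s, 1:]"
  let ?G = "[:0, 1, -1:] * (smult (int (Suc e)) G + ?X * pderiv G)"
  have "pderiv ?X = 1" by (simp add: pderiv_pCons)
  then have "euler (?X ^ Suc e * G) = [:0, 1, -1:] * (smult (int (Suc e)) (?X ^ e) * G + ?X ^ Suc e * pderiv G)"
    unfolding euler_def pderiv_mult pderiv_power_Suc by (simp add: mult_ac add.commute)
  also have "\<dots> = ?X ^ e * ?G"
    by (simp only: power_Suc distrib_left mult_smult_left mult_smult_right mult_ac)
  finally have step: "euler (?X ^ Suc e * G) = ?X ^ e * ?G" .
  have "poly ?G s = s * (1 - s) * (int (Suc e) * poly G s)"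
    by (simp add: algebra_simps)
  moreover have "\<not> p dvd int (Suc e)" using Suc.prems(1) by (auto dest!: zdvd_imp_le)
  ultimately have "\<not> p dvd poly ?G s" using s Suc.prems(2) p by (simp only: prime_dvd_mult_iff) simp
  then have "\<not> p dvd poly ((euler ^^ e) (?X ^ e * ?G)) s" using Suc.IH[of ?G] Suc.prems(1) by linarith
  then show ?case unfolding funpow_Suc_right comp_apply step .
qed simp

lemma order_from_euler_derivatives:
  fixes F :: "int poly"
  assumes p: "prime p" and s: "\<not> p dvd s * (1 - s)" and "int M \<le> p"
    and van: "\<And>m. m < M \<Longrightarrow> p dvd poly ((euler ^^ m) F) s"
  shows "\<exists>G. [:p:] dvd F - [:- s, 1:] ^ M * G"
  using assms(3,4)
proof (induction M)
  case 0
  show ?case by (rule exI[of _ F]) simp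
next
  case (Suc M)
  then obtain G where G: "[:p:] dvd F - [:- s, 1:] ^ M * G" by force
  have "p dvd poly ((euler ^^ M) F - (euler ^^ M) ([:- s, 1:] ^ M * G)) s"
    using const_poly_dvd_euler_funpow_diff[OF G] const_poly_dvd_imp_dvd_poly by blast
  then have "p dvd poly ((euler ^^ M) ([:- s, 1:] ^ M * G)) s"
    using Suc.prems(2)[of M] by (simp add: dvd_diff_right_iff)
  then have "p dvd poly G s" using euler_funpow_at_exact_order[OF p s, of M G] Suc.prems(1) by auto
  then obtain H where H: "[:p:] dvd G - [:- s, 1:] * H" by (rule linear_factor_mod)
  have "[:p:] dvd (F - [:- s, 1:] ^ M * G) + [:- s, 1:] ^ M * (G - [:- s, 1:] * H)"
    using G H by (intro dvd_add dvd_mult)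
  also have "\<dots> = F - [:- s, 1:] ^ Suc M * H" by (simp only: algebra_simps power_Suc)
  finally show ?case by blast
qed

lemma linear_power_cancel_mod:
  fixes Q :: "int poly"
  assumes p: "prime p" and Q: "\<not> p dvd poly Q s"
    and "[:p:] dvd Q * G - [:- s, 1:] ^ M * H"
  shows "\<exists>H. [:p:] dvd G - [:- s, 1:] ^ M * H"
  using assms(3)
proof (induction M arbitrary: G)
  case 0
  show ?case by (rule exI[of _ G]) simp
next
  case (Suc M)
  have "p dvd poly (Q * G - [:- s, 1:] ^ Suc M * H) s" using Suc.prems const_poly_dvd_imp_dvd_poly by blast
  then have "p dvd poly G s" using Q p by (simp add: prime_dvd_mult_iff)
  then obtain G1 where G1: "[:p:] dvd G - [:- s, 1:] * G1" by (rule linear_factor_mod)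
  have "[:p:] dvd (Q * G - [:- s, 1:] ^ Suc M * H) - Q * (G - [:- s, 1:] * G1)"
    by (rule dvd_diff[OF Suc.prems dvd_mult[OF G1]])
  also have "\<dots> = [:- s, 1:] * (Q * G1 - [:- s, 1:] ^ M * H)"
    by (simp only: algebra_simps power_Suc)
  finally have "[:p:] dvd Q * G1 - [:- s, 1:] ^ M * H"
    using prime_const_poly_dvd_mult_iff[OF p] linear_factor_nonzero_mod[OF p] by blast
  then obtain H1 where H1: "[:p:] dvd G1 - [:- s, 1:] ^ M * H1" using Suc.IH by blast
  have "[:p:] dvd (G - [:- s, 1:] * G1) + [:- s, 1:] * (G1 - [:- s, 1:] ^ M * H1)"
    using G1 H1 by (intro dvd_add dvd_mult)
  also have "\<dots> = G - [:- s, 1:] ^ Suc M * H1" by (simp only: algebra_simps power_Suc)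
  finally show ?case by blast
qed

lemma product_of_linear_powers_mod:
  fixes F :: "int poly"
  assumes p: "prime p" and fin: "finite S"
    and distinct: "\<And>s s'. s \<in> S \<Longrightarrow> s' \<in> S \<Longrightarrow> s \<noteq> s' \<Longrightarrow> \<not> p dvd s - s'"
    and ord: "\<And>s. s \<in> S \<Longrightarrow> \<exists>G. [:p:] dvd F - [:- s, 1:] ^ M * G"
  shows "\<exists>G. [:p:] dvd F - (\<Prod>s\<in>S. [:- s, 1:] ^ M) * G"
  using fin distinct ord
proof (induction S)
  case empty
  show ?case by (rule exI[of _ F]) simp
next
  case (insert s S)
  let ?Q = "\<Prod>s\<in>S. [:- s, 1:] ^ M"
  obtain G where G: "[:p:] dvd F - ?Q * G" using insert by blast
  obtain H where H: "[:p:] dvd F - [:- s, 1:] ^ M * H" using insert.prems(2) by blast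
  have Q: "\<not> p dvd poly ?Q s"
  proof
    assume "p dvd poly ?Q s"
    then have "p dvd (\<Prod>s'\<in>S. (s - s') ^ M)" by (simp add: poly_prod)
    then have "\<exists>s'\<in>S. p dvd (s - s') ^ M" by (simp add: prime_dvd_prod_iff[OF insert.hyps(1) p])
    then obtain s' where s': "s' \<in> S" "p dvd s - s'" using prime_dvd_power[OF p] by fast
    then have "s \<noteq> s'" using insert.hyps(2) by auto
    then show False using insert.prems(1)[of s s'] s' by simp
  qed
  have "[:p:] dvd (F - [:- s, 1:] ^ M * H) - (F - ?Q * G)" using G H by (rule dvd_diff[rotated])
  then have "[:p:] dvd ?Q * G - [:- s, 1:] ^ M * H" by simp
  then obtain K where K: "[:p:] dvd G - [:- s, 1:] ^ M * K" using linear_power_cancel_mod[OF p Q] by blast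
  have "[:p:] dvd (F - ?Q * G) + ?Q * (G - [:- s, 1:] ^ M * K)"
    using G K by (intro dvd_add dvd_mult)
  also have "\<dots> = F - (\<Prod>s\<in>insert s S. [:- s, 1:] ^ M) * K"
    using insert.hyps by (simp add: right_diff_distrib mult_ac)
  finally show ?case by blast
qed

text \<open>The cofactor may be reduced modulo p so that its leading coefficient is not divisible by p; then the
degree of the product is visible in F.\<close>

lemma card_multiple_roots_mod_le_degree:
  fixes F :: "int poly"
  assumes p: "prime p" and fin: "finite S"
    and distinct: "\<And>s s'. s \<in> S \<Longrightarrow> s' \<in> S \<Longrightarrow> s \<noteq> s' \<Longrightarrow> \<not> p dvd s - s'"
    and ord: "\<And>s. s \<in> S \<Longrightarrow> \<exists>G. [:p:] dvd F - [:- s, 1:] ^ M * G"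
    and F: "\<not> [:p:] dvd F"
  shows "card S * M \<le> degree F"
proof -
  let ?Q = "\<Prod>s\<in>S. [:- s, 1:] ^ M"
  obtain G where G: "[:p:] dvd F - ?Q * G" using product_of_linear_powers_mod[OF assms(1-4)] by blast
  define R where "R = map_poly (\<lambda>a. a mod p) G"
  have "[:p:] dvd G - R" by (simp add: const_poly_dvd_iff R_def coeff_map_poly mod_eq_dvd_iff[symmetric])
  then have "[:p:] dvd (F - ?Q * G) + ?Q * (G - R)" using G by (intro dvd_add dvd_mult)
  then have FR: "[:p:] dvd F - ?Q * R" by (simp add: right_diff_distrib)
  then have "R \<noteq> 0" using F by auto
  then have R: "\<not> p dvd lead_coeff R"
    by (metis R_def coeff_map_poly dvd_imp_mod_0 leading_coeff_neq_0 mod_0 mod_mod_trivial)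
  have monic: "lead_coeff ?Q = 1" by (simp add: lead_coeff_prod lead_coeff_power)
  then have Q0: "?Q \<noteq> 0" by (metis coeff_0 zero_neq_one)
  have degQ: "degree ?Q = card S * M"
    using degree_prod_eq_sum_degree[of S "\<lambda>s. [:- s, 1:] ^ M"] by (simp add: degree_power_eq)
  have "p dvd coeff (F - ?Q * R) (degree (?Q * R))" using FR by (simp add: const_poly_dvd_iff)
  moreover have "coeff (?Q * R) (degree (?Q * R)) = lead_coeff R"
    using monic by (simp only: lead_coeff_mult mult_1)
  ultimately have "\<not> p dvd coeff F (degree (?Q * R))" using R by (metis coeff_diff dvd_diff_right_iff)
  then have "degree (?Q * R) \<le> degree F" by (metis coeff_eq_0 dvd_0_right not_le)
  then show ?thesis using degree_mult_eq[OF Q0 \<open>R \<noteq> 0\<close>] degQ by linarith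
qed

section \<open>Exponents with small digits in base p\<close>

text \<open>The combinations of x^a (x^p)^b with a < A and b < B, in which x and x^p play the part of independent
variables.\<close>

definition digit_bounded :: "nat \<Rightarrow> nat \<Rightarrow> nat \<Rightarrow> int poly \<Rightarrow> bool" where
  "digit_bounded p A B f \<longleftrightarrow> (\<forall>e. coeff f e \<noteq> 0 \<longrightarrow> e mod p < A \<and> e div p < B)"

lemma digit_bounded_add: "digit_bounded p A B f \<Longrightarrow> digit_bounded p A B g \<Longrightarrow> digit_bounded p A B (f + g)"
  unfolding digit_bounded_def by (metis add.right_neutral coeff_add)

lemma digit_bounded_diff: "digit_bounded p A B f \<Longrightarrow> digit_bounded p A B g \<Longrightarrow> digit_bounded p A B (f - g)"
  unfolding digit_bounded_def by (metis diff_zero coeff_diff)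

lemma digit_bounded_smult: "digit_bounded p A B f \<Longrightarrow> digit_bounded p A B (smult a f)"
  unfolding digit_bounded_def by auto

lemma digit_bounded_sum:
  "(\<And>x. x \<in> S \<Longrightarrow> digit_bounded p A B (f x)) \<Longrightarrow> digit_bounded p A B (sum f S)"
proof (induction S rule: infinite_finite_induct)
  case (insert x S)
  then show ?case by (simp add: digit_bounded_add)
qed (simp_all add: digit_bounded_def)

lemma digit_bounded_mono:
  "digit_bounded p A B f \<Longrightarrow> A \<le> A' \<Longrightarrow> B \<le> B' \<Longrightarrow> digit_bounded p A' B' f"
  unfolding digit_bounded_def by fastforce

lemma digit_bounded_mult_x:
  assumes "digit_bounded p A B f" "A < p" shows "digit_bounded p (A + 1) B ([:0, 1:] * f)"
  unfolding digit_bounded_def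
proof (intro allI impI)
  fix e assume "coeff ([:0, 1:] * f) e \<noteq> 0"
  then obtain m where m: "e = Suc m" "coeff f m \<noteq> 0" by (cases e) (auto simp: coeff_pCons)
  then have b: "m mod p < A" "m div p < B" using assms(1) by (auto simp: digit_bounded_def)
  then have "Suc m mod p = Suc (m mod p)" using assms(2) by (simp add: mod_Suc)
  moreover from this have "Suc m div p = m div p" by (simp add: div_Suc)
  ultimately show "e mod p < A + 1 \<and> e div p < B" using b m(1) by simp
qed

lemma digit_bounded_mult_x_power_p:
  assumes "digit_bounded p A B f" "p > 0" shows "digit_bounded p A (B + 1) (monom 1 p * f)"
  unfolding digit_bounded_def
proof (intro allI impI)
  fix e assume "coeff (monom 1 p * f) e \<noteq> 0"
  then have m: "p \<le> e" "coeff f (e - p) \<noteq> 0" by (auto simp: coeff_monom_mult split: if_splits)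
  then have "(e - p) mod p < A" "(e - p) div p < B" using assms(1) unfolding digit_bounded_def by blast+
  then show "e mod p < A \<and> e div p < B + 1" using m(1) assms(2) by (simp add: le_mod_geq le_div_geq)
qed

lemma digit_bounded_connection:
  assumes "\<And>c. c \<in> I \<Longrightarrow> digit_bounded p A B (w c)" "A < p" "d \<in> I"
  shows "digit_bounded p (A + 1) (B + 1) (connection I (polylog_matrix (artin_schreier p) k) w d)"
proof -
  let ?P = "digit_bounded p (A + 1) (B + 1)"
  have p: "p > 0" using assms(2) by simp
  have lift: "?P f" if "digit_bounded p A B f" for f using digit_bounded_mono[OF that] by simp
  have x: "?P ([:0, 1:] * f)" if "digit_bounded p A B f" for f
    using digit_bounded_mono[OF digit_bounded_mult_x[OF that assms(2)]] by simp
  have xp: "?P (monom 1 p * f)" if "digit_bounded p A B f" for f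
    using digit_bounded_mono[OF digit_bounded_mult_x_power_p[OF that p]] by simp
  have theta: "digit_bounded p A B ([:0, 1:] * pderiv f)" if "digit_bounded p A B f" for f
    using that unfolding digit_bounded_def coeff_theta by auto
  have "euler f = [:0, 1:] * pderiv f - [:0, 1:] * ([:0, 1:] * pderiv f)" for f
    by (simp add: euler_factor)
  then have "?P (euler (w d))"
    using lift[OF theta] x[OF theta] assms(1)[OF assms(3)] digit_bounded_diff by metis
  moreover have "?P (w c * polylog_matrix (artin_schreier p) k c d)" if "c \<in> I" for c
  proof -
    have "w c * polylog_matrix (artin_schreier p) k c d
      = smult (first_matrix k c d) ([:0, 1:] * w c - monom 1 p * w c)
        + smult (higher_matrix k c d) (w c - [:0, 1:] * w c)"
      unfolding polylog_matrix_split artin_schreier_def by (simp add: algebra_simps smult_diff_right smult_diff_left)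
    then show ?thesis using lift x xp assms(1)[OF that]
      by (simp only:) (intro digit_bounded_add digit_bounded_smult digit_bounded_diff)
  qed
  ultimately show ?thesis unfolding connection_def by (intro digit_bounded_add digit_bounded_sum)
qed

lemma digit_bounded_connection_funpow:
  assumes "\<And>c. c \<in> I \<Longrightarrow> digit_bounded p A B (w c)" "A + m \<le> p" "d \<in> I"
  shows "digit_bounded p (A + m) (B + m) ((connection I (polylog_matrix (artin_schreier p) k) ^^ m) w d)"
  using assms(2,3)
proof (induction m arbitrary: d)
  case (Suc m)
  then have "digit_bounded p (A + m) (B + m) ((connection I (polylog_matrix (artin_schreier p) k) ^^ m) w c)" if "c \<in> I" for c
    using that by simp
  from digit_bounded_connection[where k = k, OF this _ Suc.prems(2)] Suc.prems(1) show ?case by simp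
qed (use assms in simp)

text \<open>The coefficients of the polynomial obtained when x^p is replaced by x.\<close>

definition digit_sum_coeff :: "nat \<Rightarrow> nat \<Rightarrow> int poly \<Rightarrow> nat \<Rightarrow> int" where
  "digit_sum_coeff p B f r = (\<Sum>e | e < p * B \<and> e div p + e mod p = r. coeff f e)"

lemma fermat_int:
  assumes "prime p" shows "int p dvd int a ^ p - int a"
proof (cases "p dvd a")
  case True
  then have "int p dvd int a" by simp
  then show ?thesis using prime_gt_0_nat[OF assms] by (intro dvd_diff) (auto intro: dvd_power_le dvd_trans dvd_power)
next
  case False
  then have "[int (a ^ (p - 1)) = int 1] (mod int p)"
    unfolding cong_int_iff using fermat_theorem[OF assms] by simp
  then have "int p dvd int a * (int a ^ (p - 1) - 1)" by (simp add: cong_iff_dvd_diff)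
  moreover have "int a * int a ^ (p - 1) = int a ^ p"
    using prime_gt_0_nat[OF assms] by (metis power_eq_if not_gr0)
  ultimately show ?thesis by (simp add: right_diff_distrib)
qed

lemma power_digit_sum_cong:
  assumes "prime p" shows "[int a ^ e = int a ^ (e div p + e mod p)] (mod int p)"
proof -
  have f: "[int a ^ p = int a] (mod int p)" using fermat_int[OF assms] by (simp add: cong_iff_dvd_diff)
  have "int a ^ e = (int a ^ p) ^ (e div p) * int a ^ (e mod p)"
    by (simp flip: power_mult power_add)
  also have "[\<dots> = int a ^ (e div p) * int a ^ (e mod p)] (mod int p)"
    by (intro cong_mult cong_pow f cong_refl)
  finally show ?thesis by (simp add: power_add)
qed

lemma poly_at_residue_eq_0:
  assumes p: "prime p" and f: "digit_bounded p A B f"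
    and red: "\<And>r. r < A + B \<Longrightarrow> int p dvd digit_sum_coeff p B f r"
  shows "int p dvd poly f (int a)"
proof -
  let ?g = "\<lambda>e. e div p + e mod p"
  have p0: "p > 0" using p by (rule prime_gt_0_nat)
  have supp: "coeff f e = 0" if "e \<ge> p * B" for e
  proof (rule ccontr)
    assume "coeff f e \<noteq> 0"
    then have "e div p < B" using f by (auto simp: digit_bounded_def)
    then show False using that p0 by (simp add: div_less_iff_less_mult mult.commute)
  qed
  have "poly f (int a) = (\<Sum>e<p * B. coeff f e * int a ^ e)"
    unfolding poly_altdef
  proof (rule sum.mono_neutral_cong)
    fix e assume "e \<in> {..<p * B} - {..degree f}"
    then show "coeff f e * int a ^ e = 0" by (simp add: coeff_eq_0)
  next
    fix e assume "e \<in> {..degree f} - {..<p * B}"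
    then show "coeff f e * int a ^ e = 0" using supp by simp
  qed auto
  moreover have "[(\<Sum>e<p * B. coeff f e * int a ^ e) = (\<Sum>e<p * B. coeff f e * int a ^ ?g e)] (mod int p)"
    by (intro cong_sum cong_mult power_digit_sum_cong p cong_refl)
  moreover have "(\<Sum>e<p * B. coeff f e * int a ^ ?g e) = (\<Sum>r<p + B. digit_sum_coeff p B f r * int a ^ r)"
  proof -
    have "?g ` {..<p * B} \<subseteq> {..<p + B}"
    proof (rule image_subsetI)
      fix e assume "e \<in> {..<p * B}"
      then have "e div p < B" using p0 by (simp add: div_less_iff_less_mult mult.commute)
      moreover have "e mod p < p" using p0 by simp
      ultimately show "?g e \<in> {..<p + B}" by simp
    qed
    then have "(\<Sum>e<p * B. coeff f e * int a ^ ?g e) = (\<Sum>r<p + B. \<Sum>e\<in>{e \<in> {..<p * B}. ?g e = r}. coeff f e * int a ^ ?g e)"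
      by (intro sum.group[symmetric]) auto
    also have "\<dots> = (\<Sum>r<p + B. digit_sum_coeff p B f r * int a ^ r)"
      by (intro sum.cong refl) (simp add: digit_sum_coeff_def sum_distrib_right)
    finally show ?thesis .
  qed
  moreover have "int p dvd digit_sum_coeff p B f r" for r
  proof (cases "r < A + B")
    case False
    have "digit_sum_coeff p B f r = 0" unfolding digit_sum_coeff_def
    proof (rule sum.neutral, safe)
      fix e assume "r = ?g e"
      then show "coeff f e = 0" using f False unfolding digit_bounded_def by (metis add.commute add_strict_mono)
    qed
    then show ?thesis by simp
  qed (rule red)
  then have "int p dvd (\<Sum>r<p + B. digit_sum_coeff p B f r * int a ^ r)"
    by (intro dvd_sum) simp
  ultimately show ?thesis by (metis cong_dvd_iff)
qed

section \<open>Stepanov's method\<close>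

lemma connection_diff:
  "connection I K (\<lambda>c. u c - w c) = (\<lambda>d. connection I K u d - connection I K w d)"
  by (simp add: connection_def fun_eq_iff euler_diff left_diff_distrib sum_subtractf)

lemma connection_funpow_diff:
  "(connection I K ^^ m) (\<lambda>c. u c - w c) = (\<lambda>d. (connection I K ^^ m) u d - (connection I K ^^ m) w d)"
  by (induction m) (simp_all add: connection_diff)

lemma evaluate_connection_funpow:
  assumes "prime p"
  shows "[:int p:] dvd evaluate p k C ((connection (exponents k C) (polylog_matrix (artin_schreier p) k) ^^ m) w)
    - (euler ^^ m) (evaluate p k C w)"
proof (induction m)
  case (Suc m)
  let ?w = "(connection (exponents k C) (polylog_matrix (artin_schreier p) k) ^^ m) w"
  have "[:int p:] dvd (evaluate p k C (connection (exponents k C) (polylog_matrix (artin_schreier p) k) ?w)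
      - euler (evaluate p k C ?w)) + euler (evaluate p k C ?w - (euler ^^ m) (evaluate p k C w))"
    by (intro dvd_add evaluate_connection_mod assms const_poly_dvd_euler Suc.IH)
  then show ?case by (simp add: euler_diff)
qed simp

lemma degree_polylog_monomial_le:
  assumes "c \<in> exponents k C" shows "degree (polylog_monomial p k c) \<le> C * p"
proof -
  have "degree (polylog_factor p j ^ c j) \<le> p * c j" for j
  proof -
    have "degree (polylog_factor p j) \<le> p"
      using order_trans[OF degree_polylog_le diff_le_self] by (simp add: polylog_factor_def)
    then show ?thesis using degree_power_le[of "polylog_factor p j" "c j"]
      by (meson mult_le_mono1 order_trans)
  qed
  then have "(\<Sum>j\<le>k. degree (polylog_factor p j ^ c j)) \<le> (\<Sum>j\<le>k. p * c j)" by (rule sum_mono)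
  moreover have "degree (polylog_monomial p k c) \<le> (\<Sum>j\<le>k. degree (polylog_factor p j ^ c j))"
    unfolding polylog_monomial_def using degree_prod_sum_le[of "{..k}" "\<lambda>j. polylog_factor p j ^ c j"] by (simp add: comp_def)
  moreover have "(\<Sum>j\<le>k. p * c j) = C * p"
    using assms by (simp add: exponents_def flip: sum_distrib_left)
  ultimately show ?thesis by linarith
qed

definition from_digits :: "nat \<Rightarrow> nat \<Rightarrow> nat \<Rightarrow> ('c \<times> nat \<times> nat \<Rightarrow> int) \<Rightarrow> 'c \<Rightarrow> int poly" where
  "from_digits p A B \<alpha> c = (\<Sum>b<B. \<Sum>a<A. monom (\<alpha> (c, b, a)) (p * b + a))"

lemma from_digits_diff:
  "from_digits p A B (\<lambda>x. \<alpha> x - \<beta> x) c = from_digits p A B \<alpha> c - from_digits p A B \<beta> c"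
  by (simp add: from_digits_def sum_subtractf flip: diff_monom)

lemma digit_bounded_from_digits:
  assumes "A \<le> p" shows "digit_bounded p A B (from_digits p A B \<alpha> c)"
  unfolding from_digits_def
proof (intro digit_bounded_sum)
  fix b a assume "b \<in> {..<B}" "a \<in> {..<A}"
  then show "digit_bounded p A B (monom (\<alpha> (c, b, a)) (p * b + a))"
    using assms by (auto simp: digit_bounded_def)
qed

lemma degree_from_digits_le:
  assumes "A \<le> p" shows "degree (from_digits p A B \<alpha> c) \<le> p * B"
proof (rule degree_le, intro allI impI)
  fix e assume e: "p * B < e"
  show "coeff (from_digits p A B \<alpha> c) e = 0"
  proof (rule ccontr)
    assume "coeff (from_digits p A B \<alpha> c) e \<noteq> 0"
    then have "e mod p < A" "e div p < B"
      using digit_bounded_from_digits[OF assms, of B \<alpha> c] unfolding digit_bounded_def by blast+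
    moreover from this(1) have "p > 0" using assms by (cases p) auto
    ultimately have "e < p * B" by (simp add: div_less_iff_less_mult mult.commute)
    then show False using e by simp
  qed
qed

text \<open>Let b be the least exponent of x^p that occurs in some coefficient modulo p. After division by x^(p b), the
terms with larger exponents of x^p vanish modulo x^p, and the zero estimate applies to the rest.\<close>

lemma evaluate_from_digits_nonzero:
  fixes \<alpha> :: "(nat \<Rightarrow> nat) \<times> nat \<times> nat \<Rightarrow> int"
  assumes p: "prime p" and C: "C < p"
    and small: "(card (exponents k C) + 1) * (A + card (exponents k C)) < p"
    and nz: "\<exists>x\<in>exponents k C \<times> {..<B} \<times> {..<A}. \<not> int p dvd \<alpha> x"
  shows "\<not> [:int p:] dvd evaluate p k C (from_digits p A B \<alpha>)"
proof
  assume zero: "[:int p:] dvd evaluate p k C (from_digits p A B \<alpha>)"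
  let ?I = "exponents k C"
  define U where "U = (\<lambda>b c. \<Sum>a<A. monom (\<alpha> (c, b, a)) a)"
  have coeffU: "coeff (U b c) a = \<alpha> (c, b, a)" if "a < A" for a b c
    using that by (simp add: U_def coeff_sum)
  have degU: "degree (U b c) \<le> A" for b c
    unfolding U_def by (intro degree_sum_le) (auto intro: order_trans[OF degree_monom_le])
  define P where "P = (\<lambda>b. b < B \<and> (\<exists>c\<in>?I. \<not> [:int p:] dvd U b c))"
  obtain c b a where x: "c \<in> ?I" "b < B" "a < A" "\<not> int p dvd \<alpha> (c, b, a)" using nz by auto
  have "\<not> [:int p:] dvd U b c" using x coeffU by (metis const_poly_dvd_iff)
  then have "P b" using x by (auto simp: P_def)
  define b0 where "b0 = (LEAST b. P b)"
  have b0: "b0 < B" "\<exists>c\<in>?I. \<not> [:int p:] dvd U b0 c"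
    using LeastI[of P, OF \<open>P b\<close>] by (auto simp: b0_def P_def)
  have below: "[:int p:] dvd evaluate p k C (U b)" if "b < b0" for b
  proof -
    have "\<not> P b" using that not_less_Least by (auto simp: b0_def)
    then have "[:int p:] dvd U b c" if "c \<in> ?I" for c using that \<open>b < b0\<close> b0(1) by (auto simp: P_def)
    then show ?thesis unfolding evaluate_def by (auto intro!: dvd_sum dvd_mult2)
  qed
  have "from_digits p A B \<alpha> c = (\<Sum>b<B. monom 1 (p * b) * U b c)" for c
    by (simp add: from_digits_def U_def sum_distrib_left mult_monom)
  then have "evaluate p k C (from_digits p A B \<alpha>) = (\<Sum>b<B. monom 1 (p * b) * evaluate p k C (U b))"
    unfolding evaluate_def sum_distrib_left by (simp add: sum_distrib_right sum.swap[of _ ?I] mult.assoc)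
  also have "{..<B} = {..<b0} \<union> {b0..<B}" using b0(1) by auto
  also have "(\<Sum>b\<in>{..<b0} \<union> {b0..<B}. monom 1 (p * b) * evaluate p k C (U b))
     = (\<Sum>b<b0. monom 1 (p * b) * evaluate p k C (U b)) + (\<Sum>b=b0..<B. monom 1 (p * b) * evaluate p k C (U b))"
    by (rule sum.union_disjoint) auto
  finally have "[:int p:] dvd (\<Sum>b<b0. monom 1 (p * b) * evaluate p k C (U b)) + (\<Sum>b=b0..<B. monom 1 (p * b) * evaluate p k C (U b))"
    using zero by simp
  moreover have "[:int p:] dvd (\<Sum>b<b0. monom 1 (p * b) * evaluate p k C (U b))"
    using below by (auto intro!: dvd_sum dvd_mult)
  ultimately have "[:int p:] dvd (\<Sum>b=b0..<B. monom 1 (p * b) * evaluate p k C (U b))"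
    by (simp only: dvd_add_right_iff)
  also have "(\<Sum>b=b0..<B. monom 1 (p * b) * evaluate p k C (U b))
    = monom 1 (p * b0) * (\<Sum>b=b0..<B. monom 1 (p * (b - b0)) * evaluate p k C (U b))"
    unfolding sum_distrib_left mult.assoc[symmetric] mult_monom
    by (intro sum.cong refl) (simp flip: distrib_left)
  finally have "[:int p:] dvd (\<Sum>b=b0..<B. monom 1 (p * (b - b0)) * evaluate p k C (U b))"
  proof -
    assume a: "[:int p:] dvd monom 1 (p * b0) * (\<Sum>b=b0..<B. monom 1 (p * (b - b0)) * evaluate p k C (U b))"
    have "\<not> [:int p:] dvd monom 1 (p * b0)"
      unfolding const_poly_dvd_iff not_all
      by (rule exI[of _ "p * b0"]) (use p in \<open>auto simp: not_prime_unit\<close>)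
    then show ?thesis using a prime_const_poly_dvd_mult_iff[of "int p"] p by auto
  qed
  moreover have split: "(\<Sum>b=b0..<B. monom 1 (p * (b - b0)) * evaluate p k C (U b)) = evaluate p k C (U b0)
     + (\<Sum>b\<in>{b0..<B} - {b0}. monom 1 (p * (b - b0)) * evaluate p k C (U b))"
    using b0(1) by (subst sum.remove[of _ b0]) (auto simp flip: one_pCons simp: monom_0)
  moreover have "low_order_zero p (monom 1 (p * (b - b0)) * evaluate p k C (U b))" if "b \<in> {b0..<B} - {b0}" for b
  proof -
    have "p * (b - b0) = p * (b - b0 - 1) + p" using that by (cases "b - b0") auto
    then have "monom 1 (p * (b - b0)) = monom 1 (p * (b - b0 - 1)) * (monom 1 p :: int poly)"
      by (simp add: mult_monom)
    then have "monom 1 (p * (b - b0)) * evaluate p k C (U b)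
      = (monom 1 (p * (b - b0 - 1)) * evaluate p k C (U b)) * monom 1 p"
      by (simp only: mult_ac)
    then show ?thesis by (simp only: low_order_zero_mult low_order_zero_monom)
  qed
  then have "low_order_zero p (\<Sum>b\<in>{b0..<B} - {b0}. - (monom 1 (p * (b - b0)) * evaluate p k C (U b)))"
    by (intro low_order_zero_sum) (simp add: low_order_zero_def)
  ultimately have "low_order_zero p ((\<Sum>b=b0..<B. monom 1 (p * (b - b0)) * evaluate p k C (U b))
     + (\<Sum>b\<in>{b0..<B} - {b0}. - (monom 1 (p * (b - b0)) * evaluate p k C (U b))))"
    by (simp only: low_order_zero_add low_order_zero_dvd)
  also have "\<dots> = evaluate p k C (U b0)"
    unfolding split by (simp add: sum_negf)
  finally show False
    using zero_estimate[OF p C small, of "U b0"] degU b0(2) by blast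
qed

lemma polylog_monomial_root:
  assumes "k \<ge> 1" "int p dvd poly (polylog p k) s" "0 < c k"
  shows "int p dvd poly (polylog_monomial p k c) s"
proof -
  have "polylog_monomial p k c = polylog_factor p k ^ c k * (\<Prod>j\<in>{..k} - {k}. polylog_factor p j ^ c j)"
    unfolding polylog_monomial_def by (rule prod.remove) auto
  moreover have "int p dvd poly (polylog p k) s ^ c k" using assms(3) by (intro dvd_trans[OF assms(2) dvd_power]) simp
  ultimately show ?thesis using assms(1) by (simp add: polylog_factor_def poly_power)
qed

text \<open>The unknowns are the n k C * B * A coefficients of the entries of v. The conditions are, for m < M
and each monomial free of L_k, that the coefficient after m applications of the connection, reduced
by x^p = x to degree less than A + B + 2 M, vanishes modulo p. Each application raises both digit bounds
by at most one.\<close>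

lemma stepanov_bound:
  fixes S :: "nat set"
  defines "n \<equiv> \<lambda>k C. card (exponents k C)"
  assumes p: "prime p" and k: "k \<ge> 1" and C: "C < p" and MA: "A + M \<le> p"
    and small: "(n k C + 1) * (A + n k C) < p"
    and count: "M * (card {c \<in> exponents k C. c k = 0} * (A + B + 2 * M)) < n k C * (B * A)"
    and S: "S \<subseteq> {2..<p}" and roots: "\<And>s. s \<in> S \<Longrightarrow> int p dvd poly (polylog p k) (int s)"
  shows "card S * M \<le> p * (B + C)"
proof -
  let ?I = "exponents k C" and ?D = "connection (exponents k C) (polylog_matrix (artin_schreier p) k)"
  let ?J = "{c \<in> ?I. c k = 0}"
  let ?X = "?I \<times> {..<B} \<times> {..<A}" and ?Y = "{..<M} \<times> ?J \<times> {..<A + B + 2 * M}"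
  have pp: "prime (int p)" using p by simp
  define Phi where "Phi = (\<lambda>\<alpha> y. digit_sum_coeff p (B + fst y)
      ((?D ^^ fst y) (from_digits p A B \<alpha>) (fst (snd y))) (snd (snd y)))"
  have diff: "Phi (\<lambda>x. \<alpha> x - \<beta> x) y = Phi \<alpha> y - Phi \<beta> y" if "y \<in> ?Y" for \<alpha> \<beta> y
  proof -
    have "from_digits p A B (\<lambda>x. \<alpha> x - \<beta> x) = (\<lambda>c. from_digits p A B \<alpha> c - from_digits p A B \<beta> c)"
      by (simp add: fun_eq_iff from_digits_diff)
    then show ?thesis
      by (simp add: Phi_def connection_funpow_diff digit_sum_coeff_def sum_subtractf)
  qed
  have fin: "finite ?X" "finite ?Y" using finite_exponents by auto
  have card: "card ?Y < card ?X" using count unfolding n_def card_cartesian_product card_lessThan .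
  obtain \<alpha> where nz: "\<exists>x\<in>?X. \<not> int p dvd \<alpha> x" and van: "\<And>y. y \<in> ?Y \<Longrightarrow> int p dvd Phi \<alpha> y"
    by (rule additive_pigeonhole_mod[where Phi = Phi, OF fin card prime_gt_1_int[OF pp] diff];
        (assumption | (rule that; (assumption | blast))))
  let ?v = "from_digits p A B \<alpha>"
  define F where "F = evaluate p k C ?v"
  have F0: "\<not> [:int p:] dvd F"
    unfolding F_def by (rule evaluate_from_digits_nonzero[OF p C _ nz]) (use small in \<open>simp add: n_def\<close>)
  have Ap: "A \<le> p" using MA by simp
  have zero: "int p dvd poly ((euler ^^ m) F) (int s)" if s: "s \<in> S" and m: "m < M" for s m
  proof -
    have "int p dvd poly ((?D ^^ m) ?v c * polylog_monomial p k c) (int s)" if c: "c \<in> ?I" for c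
    proof (cases "c k = 0")
      case True
      have "int p dvd poly ((?D ^^ m) ?v c) (int s)"
      proof (rule poly_at_residue_eq_0[OF p])
        show "digit_bounded p (A + m) (B + m) ((?D ^^ m) ?v c)"
          by (rule digit_bounded_connection_funpow) (use digit_bounded_from_digits[OF Ap] m MA c in auto)
        fix r assume "r < A + m + (B + m)"
        then show "int p dvd digit_sum_coeff p (B + m) ((?D ^^ m) ?v c) r"
          using van[of "(m, c, r)"] m c True by (simp add: Phi_def)
      qed
      then show ?thesis by simp
    next
      case False
      then show ?thesis using polylog_monomial_root[OF k roots[OF s]] by simp
    qed
    then have "int p dvd poly (evaluate p k C ((?D ^^ m) ?v)) (int s)"
      unfolding evaluate_def poly_sum by (rule dvd_sum)
    moreover have "int p dvd poly (evaluate p k C ((?D ^^ m) ?v) - (euler ^^ m) F) (int s)"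
      unfolding F_def by (rule const_poly_dvd_imp_dvd_poly[OF evaluate_connection_funpow[OF p]])
    ultimately show ?thesis unfolding poly_diff by (simp only: dvd_diff_right_iff)
  qed
  have ord: "\<exists>G. [:int p:] dvd F - [:- s, 1:] ^ M * G" if s: "s \<in> int ` S" for s
  proof (rule order_from_euler_derivatives[OF pp])
    obtain t where t: "s = int t" "t \<in> S" using s by auto
    then have "2 \<le> t" "t < p" using S by auto
    then have "\<not> int p dvd s" "\<not> int p dvd s - 1" using t(1) by (auto dest!: zdvd_imp_le)
    then have "\<not> int p dvd s" "\<not> int p dvd 1 - s" by (auto simp: dvd_diff_commute)
    then show "\<not> int p dvd s * (1 - s)" using pp by (simp add: prime_dvd_mult_iff)
    show "int M \<le> int p" using MA by simp
    show "int p dvd poly ((euler ^^ m) F) s" if "m < M" for m using zero t that by simp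
  qed
  have distinct: "\<not> int p dvd s - s'" if ss: "s \<in> int ` S" "s' \<in> int ` S" "s \<noteq> s'" for s s'
  proof -
    obtain a b where "s = int a" "s' = int b" "a \<in> S" "b \<in> S" using ss(1,2) by blast
    moreover from this have "a < p" "b < p" using S by auto
    ultimately show ?thesis using int_diff_not_dvd[of a b "int p"] ss(3) by auto
  qed
  have "finite (int ` S)" using S by (auto intro: finite_subset)
  then have "card (int ` S) * M \<le> degree F"
    using card_multiple_roots_mod_le_degree[OF pp _ distinct ord F0] by simp
  moreover have "card (int ` S) = card S" by (simp add: card_image)
  moreover have "degree F \<le> p * (B + C)"
    unfolding F_def evaluate_def
  proof (rule degree_sum_le[OF finite_exponents])
    fix c assume c: "c \<in> ?I"
    show "degree (?v c * polylog_monomial p k c) \<le> p * (B + C)"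
      using degree_mult_le[of "?v c" "polylog_monomial p k c"] degree_from_digits_le[OF Ap, of B \<alpha> c]
        degree_polylog_monomial_le[OF c, of p] by (simp add: distrib_left mult.commute)
  qed
  ultimately show ?thesis by simp
qed

section \<open>The bound for the truncated polylogarithm\<close>

text \<open>Clearing a common denominator turns the congruence between rational numbers into divisibility.\<close>

lemma rat_cong_0_multiple:
  assumes "rat_cong p r 0" "r * of_int D = of_int Z"
  shows "int p dvd Z"
proof -
  obtain c where c: "p_integral p c" "r = of_nat p * c"
    using assms(1) by (auto simp: rat_cong_def)
  obtain n d where nd: "quotient_of c = (n, d)" by force
  have d: "d > 0" using quotient_of_denom_pos[OF nd] .
  have "of_int (Z * d) = (of_int (int p * (n * D)) :: rat)"
    using assms(2) c(2) quotient_of_div[OF nd] d by (simp add: field_simps)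
  then have "Z * d = int p * (n * D)" by (simp only: of_int_eq_iff)
  then have "int p dvd Z * d" by simp
  moreover have "coprime (int p) d" using c(1) nd by (simp add: p_integral_def coprime_commute)
  ultimately show ?thesis using coprime_dvd_mult_left_iff by blast
qed

lemma rat_cong_trunc_polylog_imp_root:
  assumes p: "prime p" and "rat_cong p (poly (trunc_polylog k p) (of_int x)) 0"
  shows "int p dvd poly (polylog p k) x"
proof -
  define D where "D = (\<Prod>i=1..p-1. int i) ^ k"
  define E where "E = (\<lambda>i. (\<Prod>j\<in>{1..p-1}-{i}. int j) ^ k)"
  have DE: "D = int i ^ k * E i" if "i \<in> {1..p-1}" for i
    using that by (simp add: D_def E_def prod.remove[of _ i] power_mult_distrib)
  have "poly (trunc_polylog k p) (of_int x) * of_int D = (\<Sum>i=1..p-1. of_int (E i * x ^ i))"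
    unfolding trunc_polylog_def poly_sum sum_distrib_right
  proof (rule sum.cong[OF refl])
    fix i assume i: "i \<in> {1..p-1}"
    then have "(of_nat i :: rat) \<noteq> 0" by auto
    then show "poly (monom (1 / of_nat i ^ k) i) (of_int x) * of_int D = (of_int (E i * x ^ i) :: rat)"
      unfolding DE[OF i] by (simp add: poly_monom)
  qed
  then have "int p dvd (\<Sum>i=1..p-1. E i * x ^ i)"
    using rat_cong_0_multiple[OF assms(2)] by (simp only: of_int_sum[symmetric])
  moreover have "int p dvd D * (\<Sum>i=1..p-1. (int i ^ (p - 2)) ^ k * x ^ i) - (\<Sum>i=1..p-1. E i * x ^ i)"
    unfolding sum_distrib_left sum_subtractf[symmetric]
  proof (rule dvd_sum)
    fix i assume i: "i \<in> {1..p-1}"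
    have "int p dvd (int i * int i ^ (p - 2)) ^ k - 1 ^ k"
      using cong_pow[of "int i * int i ^ (p - 2)" 1 "int p" k] modular_inverse_power[OF p i]
      by (simp only: cong_iff_dvd_diff)
    then have "int p dvd ((int i * int i ^ (p - 2)) ^ k - 1) * (E i * x ^ i)" by simp
    then show "int p dvd D * ((int i ^ (p - 2)) ^ k * x ^ i) - E i * x ^ i"
      unfolding DE[OF i] by (simp add: algebra_simps power_mult_distrib)
  qed
  ultimately have "int p dvd D * (\<Sum>i=1..p-1. (int i ^ (p - 2)) ^ k * x ^ i)"
    by (simp only: dvd_diff_left_iff)
  moreover have "\<not> int p dvd D"
  proof
    assume "int p dvd D"
    then have "int p dvd (\<Prod>i=1..p-1. int i)" unfolding D_def by (rule prime_dvd_power[rotated]) (use p in simp)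
    then obtain i where "i \<in> {1..p-1}" "int p dvd int i"
      using p prime_dvd_prod_iff[of "{1..p-1}" "int p" int] by auto
    then show False by (auto dest!: dvd_imp_le)
  qed
  ultimately have "int p dvd (\<Sum>i=1..p-1. (int i ^ (p - 2)) ^ k * x ^ i)"
    using p by (simp add: prime_dvd_mult_iff)
  then show ?thesis by (simp add: polylog_def poly_sum poly_monom)
qed

lemma num_roots_mod_trunc_polylog_le:
  assumes p: "prime p"
  shows "num_roots_mod p (trunc_polylog k p) \<le> 2 + card {s \<in> {2..<p}. int p dvd poly (polylog p k) (int s)}"
proof -
  let ?S = "{s \<in> {2..<p}. int p dvd poly (polylog p k) (int s)}"
  have "{x \<in> {0..<int p}. rat_cong p (poly (trunc_polylog k p) (of_int x)) 0} \<subseteq> {0, 1} \<union> int ` ?S"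
  proof
    fix x assume x: "x \<in> {x \<in> {0..<int p}. rat_cong p (poly (trunc_polylog k p) (of_int x)) 0}"
    then have "int p dvd poly (polylog p k) x" using rat_cong_trunc_polylog_imp_root[OF p] by blast
    moreover obtain s where s: "x = int s" using x nonneg_int_cases by auto
    ultimately have "x \<in> {0, 1} \<or> s \<in> ?S" using x by auto
    then show "x \<in> {0, 1} \<union> int ` ?S" using s by blast
  qed
  then have "num_roots_mod p (trunc_polylog k p) \<le> card ({0, 1} \<union> int ` ?S)"
    unfolding num_roots_mod_def by (intro card_mono) auto
  also have "\<dots> \<le> card {0, 1 :: int} + card (int ` ?S)" by (rule card_Un_le)
  also have "card (int ` ?S) = card ?S" by (simp add: card_image)
  finally show ?thesis by simp
qed

text \<open>Parameters for Stepanov's bound: with B = C = 2 k h, M = k h^2 and A = C + 2 M the counting condition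
follows from 2 k M < C^2, and p (B + C) / M = 4 p / h.\<close>

lemma card_polylog_roots_le:
  assumes p: "prime p" and k: "k \<ge> 1" and h: "h \<ge> 1" and small: "4 * (3 * k * h) ^ (2 * k + 2) < p"
    and S: "S = {s \<in> {2..<p}. int p dvd poly (polylog p k) (int s)}"
  shows "card S * h \<le> 4 * p"
proof -
  define C where "C = 2 * k * h"
  define M where "M = k * h ^ 2"
  define A where "A = C + 2 * M"
  define n where "n = card (exponents k C)"
  define N where "N = (3 * k * h) ^ (k + 1)"
  have kh: "k * h \<ge> 1" using k h by simp
  have "n \<le> (C + 1) ^ (k + 1)" unfolding n_def by (rule card_exponents_le)
  also have "\<dots> \<le> N" unfolding N_def C_def using kh by (intro power_mono) auto
  finally have nN: "n \<le> N" .
  have "(3 * k * h) ^ 2 \<le> N" unfolding N_def using kh k by (intro power_increasing) auto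
  then have sq: "9 * (k * h) ^ 2 \<le> N" by (simp add: power_mult_distrib)
  have "k * h \<le> (k * h) ^ 2" using kh by (simp add: power2_eq_square)
  moreover have "M \<le> (k * h) ^ 2" unfolding M_def using k by (simp add: power_mult_distrib power2_eq_square)
  ultimately have AM: "A + M \<le> 5 * (k * h) ^ 2" "A \<le> 4 * (k * h) ^ 2" unfolding A_def C_def by linarith+
  have "(k * h) ^ 2 \<ge> 1" using kh by (rule one_le_power)
  then have N1: "N \<ge> 9" using sq by linarith
  have "N * N = (3 * k * h) ^ (2 * k + 2)"
    unfolding N_def power_add[symmetric] by (simp add: mult_2)
  then have N2: "4 * (N * N) < p" using small by simp
  have Np: "N \<le> N * N" using N1 by simp
  have "(n + 1) * (A + n) \<le> (2 * N) * (2 * N)"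
    using nN N1 AM sq by (intro mult_mono) linarith+
  then have small': "(n + 1) * (A + n) < p" using N2 by simp
  have MAp: "A + M \<le> p" using AM(1) sq Np N2 by linarith
  have "C \<le> A" by (simp add: A_def)
  then have Cp: "C < p" using AM(2) sq Np N2 N1 by linarith
  have C0: "C \<ge> 1" using kh by (simp add: C_def)
  define m where "m = card {c \<in> exponents k C. c k = 0}"
  have ratio: "C * m \<le> k * n" unfolding m_def n_def by (rule card_exponents_ratio[OF k])
  have n0: "n > 0"
  proof -
    have "bottom_exponent C \<in> exponents k C" by (simp add: exponents_def bottom_exponent_def)
    then show ?thesis unfolding n_def using finite_exponents card_gt_0_iff by blast
  qed
  have count: "M * (m * (A + C + 2 * M)) < n * (C * A)"
  proof -
    have "A + C + 2 * M = 2 * A" by (simp add: A_def)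
    then have "C * (M * (m * (A + C + 2 * M))) = (2 * M * A) * (C * m)" by (simp add: mult_ac)
    also have "\<dots> \<le> (2 * M * A) * (k * n)" using ratio by (rule mult_left_mono) simp
    also have "\<dots> = (2 * k * M) * (A * n)" by (simp add: mult_ac)
    also have "\<dots> < (C * C) * (A * n)"
    proof (rule mult_strict_right_mono)
      have "2 * k * M = 2 * (k * h) ^ 2" "C * C = 4 * (k * h) ^ 2"
        by (simp_all add: M_def C_def power2_eq_square mult_ac)
      moreover have "(k * h) ^ 2 > 0" using kh by simp
      ultimately show "2 * k * M < C * C" by linarith
      show "0 < A * n" using n0 C0 by (simp add: A_def)
    qed
    also have "\<dots> = C * (n * (C * A))" by (simp add: mult_ac)
    finally show ?thesis by simp
  qed
  have "card S * M \<le> p * (C + C)"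
    by (rule stepanov_bound[OF p k Cp MAp, where B = C])
      (use small' count S in \<open>auto simp: n_def m_def\<close>)
  then have "(k * h) * (card S * h) \<le> (k * h) * (4 * p)"
    by (simp add: M_def C_def power2_eq_square mult_ac)
  then show ?thesis using kh by simp
qed

text \<open>The residues 0 and 1, where the factor of E vanishes, are counted separately. Taking h to be the integer
part of ln p satisfies the size condition for all large p; for the remaining p the trivial bound p on the
number of roots suffices, with a constant that absorbs ln p.\<close>

theorem theorem1:
  fixes k :: nat
  assumes "k \<ge> 2"
  shows "\<exists>C :: real. C > 0 \<and> (\<forall>p :: nat. prime p \<and> p \<ge> 3 \<longrightarrow>
           real (num_roots_mod p (trunc_polylog k p)) \<le> C * real p / ln (real p))"
proof -
  have k: "k \<ge> 1" using assms by simp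
  \<comment> \<open>The size condition for h at most ln p holds for all large p.\<close>
  have "((\<lambda>x::real. ln x ^ (2 * k + 2) / exp (ln x)) \<longlongrightarrow> 0) at_top"
    by (rule filterlim_compose[OF tendsto_power_div_exp_0 ln_at_top])
  then have "((\<lambda>x::real. (4 * (3 * real k) ^ (2 * k + 2)) * (ln x ^ (2 * k + 2) / exp (ln x))) \<longlongrightarrow> 0) at_top"
    by (rule tendsto_mult_right_zero)
  moreover have "eventually (\<lambda>x::real. (4 * (3 * real k) ^ (2 * k + 2)) * (ln x ^ (2 * k + 2) / exp (ln x))
      = 4 * (3 * real k * ln x) ^ (2 * k + 2) / x) at_top"
    using eventually_gt_at_top[of "0::real"] by eventually_elim (simp add: power_mult_distrib)
  ultimately have "((\<lambda>x::real. 4 * (3 * real k * ln x) ^ (2 * k + 2) / x) \<longlongrightarrow> 0) at_top"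
    by (rule Lim_transform_eventually)
  then have "eventually (\<lambda>x::real. 4 * (3 * real k * ln x) ^ (2 * k + 2) / x < 1) at_top"
    by (rule order_tendstoD) simp
  then obtain P where P: "\<And>x. x \<ge> P \<Longrightarrow> 4 * (3 * real k * ln x) ^ (2 * k + 2) / x < 1"
    unfolding eventually_at_top_linorder by blast
  define C where "C = max 10 (ln \<bar>P\<bar> + 1)"
  have "real (num_roots_mod p (trunc_polylog k p)) \<le> C * real p / ln (real p)" if p: "prime p" "p \<ge> 3" for p
  proof -
    have ln1: "ln (real p) \<ge> 1"
    proof -
      have "exp 1 \<le> real p" using exp_le p(2) by linarith
      then show ?thesis using p(2) by (simp add: ln_ge_iff)
    qed
    let ?N = "num_roots_mod p (trunc_polylog k p)"
    show ?thesis
    proof (cases "real p \<ge> P")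
      case True
      define h where "h = nat \<lfloor>ln (real p)\<rfloor>"
      have h1: "h \<ge> 1" using ln1 by (simp add: h_def le_nat_floor)
      have h_le: "real h \<le> ln (real p)" using ln1 by (simp add: h_def)
      have h_ge: "ln (real p) \<le> 2 * real h"
      proof -
        have "ln (real p) < real h + 1" using ln1 by (simp add: h_def)
        then show ?thesis using h1 by simp
      qed
      have "real (4 * (3 * k * h) ^ (2 * k + 2)) \<le> 4 * (3 * real k * ln (real p)) ^ (2 * k + 2)"
        unfolding of_nat_mult of_nat_power of_nat_numeral
        using h_le by (intro mult_left_mono power_mono) auto
      also have "\<dots> < real p" using P[OF True] p(2) by (simp add: divide_less_eq)
      finally have small: "4 * (3 * k * h) ^ (2 * k + 2) < p" by (simp only: of_nat_less_iff)
      let ?S = "{s \<in> {2..<p}. int p dvd poly (polylog p k) (int s)}"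
      have "card ?S * h \<le> 4 * p" using card_polylog_roots_le[OF p(1) k h1 small] by simp
      then have "real (card ?S * h) \<le> real (4 * p)" by (simp only: of_nat_le_iff)
      then have S: "real (card ?S) * real h \<le> 4 * real p" by simp
      have "real ?N * ln (real p) \<le> (2 + real (card ?S)) * ln (real p)"
        using num_roots_mod_trunc_polylog_le[OF p(1), of k] ln1 by (intro mult_right_mono) linarith+
      also have "\<dots> = 2 * ln (real p) + real (card ?S) * ln (real p)" by (simp add: algebra_simps)
      also have "\<dots> \<le> 2 * real p + real (card ?S) * (2 * real h)"
        using h_ge ln_le_minus_one[of "real p"] p(2) by (intro add_mono mult_left_mono) auto
      also have "\<dots> = 2 * real p + 2 * (real (card ?S) * real h)" by simp
      also have "\<dots> \<le> 10 * real p" using S by linarith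
      also have "\<dots> \<le> C * real p" by (intro mult_right_mono) (auto simp: C_def)
      finally show ?thesis using ln1 by (simp add: pos_le_divide_eq)
    next
      case False
      have "?N \<le> card {0..<int p}" unfolding num_roots_mod_def by (intro card_mono) auto
      then have "real ?N \<le> real p" by simp
      moreover have "ln (real p) \<le> C"
      proof -
        have "ln (real p) \<le> ln \<bar>P\<bar>" using False p(2) by simp
        then show ?thesis by (simp add: C_def)
      qed
      ultimately have "real ?N * ln (real p) \<le> real p * C" using ln1 by (intro mult_mono) auto
      then show ?thesis using ln1 by (simp add: pos_le_divide_eq mult.commute)
    qed
  qed
  then show ?thesis by (intro exI[of _ C]) (auto simp: C_def)
qed

end
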